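(* Let $\Gamma_0>0$ and let $\hat p:D(\Gamma_0)\to\mathbb{R}$ be a nondegenerate reference pressure. Let $P_0$ be a regular value of $\hat p$, and let $\psi:\zeta\mapsto\psi_\zeta$ be a solution of the Euler–Lagrange equations of the spatial dynamics action $\mathcal S_{\hat p}$. For each $\zeta$ let $c_\zeta(P_0)=\{(x,y)\in D: p_\zeta(x,y)=P_0\}$ be the isobar of $p_\zeta=\psi_\zeta^*\hat p$. Then for any $\zeta_1\le\zeta_2$, $$\oint_{c_{\zeta_1}(P_0)}\pi_{\zeta_1}=\oint_{c_{\zeta_2}(P_0)}\pi_{\zeta_2},\qquad \pi_\zeta=n_\zeta(\bm u_\zeta+\bm N_\zeta)^\flat,\ n_\zeta=\frac{\varrho_\zeta}{\omega_\zeta}.$$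
   Context: $D$ is the closed unit disc; $D(\Gamma_0)\subset\mathbb{R}^2$ is the closed disc centered at the origin with area $\Gamma_0$, coordinates $(U,V)$. A reference pressure $\hat p:D(\Gamma_0)\to\mathbb{R}$ is nondegenerate if it is constant on $\partial D(\Gamma_0)$ and $d\hat p$ vanishes at exactly one point of $D(\Gamma_0)$. Geometric data: $Q\subset\mathbb{R}^3$ a toroidal domain (orientation-preserving diffeomorphism $(\zeta,x,y):Q\to S^1\times D$), $\widetilde Q$ its universal cover with pulled-back Euclidean metric $\widetilde g$, volume form $\Omega$, lifted coordinates $(\zeta,x,y)\in\mathbb{R}\times D$, $I_\zeta:D\to\widetilde Q$, $I_\zeta(x,y)=(\zeta,x,y)$. On $D$: $h_\zeta=I_\zeta^*\widetilde g$; shift vector $\bm N_\zeta$ with $\iota_{\bm N_\zeta}h_\zeta=I_\zeta^*(\iota_{\partial_\zeta}\widetilde g)$; lapse $N_\zeta$ with $N_\zeta^2=I_\zeta^*(\widetilde g(\partial_\zeta,\partial_\zeta))-h_\zeta(\bm N_\zeta,\bm N_\zeta)$; $\omega_\zeta=I_\zeta^*(\iota_{\partial_\zeta}\Omega)$; $\flat$, $|\cdot|$ with respect to $h_\zeta$. For a path of diffeomorphisms $\psi_\zeta:D\to D(\Gamma_0)$: $\bm u_\zeta=-[D\psi_\zeta]^{-1}\partial_\zeta\psi_\zeta$, $p_\zeta=\psi_\zeta^*\hat p$, $\varrho_\zeta=\psi_\zeta^*(dU\wedge dV)$, $n_\zeta$ the function with $\varrho_\zeta=n_\zeta\omega_\zeta$.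 The spatial dynamics action is $\mathcal S_{\hat p}(\psi)=\int\int_D[\tfrac12 n_\zeta^2|\bm u_\zeta+\bm N_\zeta|^2+\tfrac12 n_\zeta^2N_\zeta^2-p_\zeta]\,\omega_\zeta\,d\zeta$; its Euler–Lagrange equations (stationarity under fixed-endpoint variations) are $(\partial_\zeta+\mathcal L_{\bm u_\zeta})(n_\zeta(\bm u_\zeta+\bm N_\zeta)^\flat)=dp_\zeta/n_\zeta+d(n_\zeta(|\bm u_\zeta+\bm N_\zeta|^2+N_\zeta^2))$. The isobars are oriented consistently as boundaries of the discs they enclose in $D$. *)

theory Defs
  imports "HOL-Analysis.Analysis" "HOL-Complex_Analysis.Complex_Analysis"
begin

fun Ck_on :: "nat \<Rightarrow> 'a::real_normed_vector set \<Rightarrow> ('a \<Rightarrow> 'b::real_normed_vector) \<Rightarrow> bool" where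
  "Ck_on 0 S f = continuous_on S f"
| "Ck_on (Suc k) S f =
     ((\<forall>x\<in>S. f differentiable (at x)) \<and>
      (\<forall>v. Ck_on k S (\<lambda>x. frechet_derivative f (at x) v)))"

definition smooth_on :: "'a::real_normed_vector set \<Rightarrow> ('a \<Rightarrow> 'b::real_normed_vector) \<Rightarrow> bool" where
  "smooth_on S f \<longleftrightarrow> open S \<and> (\<forall>k. Ck_on k S f)"

definition smooth_near :: "'a::real_normed_vector set \<Rightarrow> ('a \<Rightarrow> 'b::real_normed_vector) \<Rightarrow> bool" where
  "smooth_near A f \<longleftrightarrow> (\<exists>U. A \<subseteq> U \<and> smooth_on U f)"

(* ---------- Planar conventions: R^2 is modelled by complex, (x,y) = (Re, Im) ---------- *)

abbreviation unit_disc :: "complex set" where "unit_disc \<equiv> cball 0 1"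

definition disc_area :: "real \<Rightarrow> complex set" where
  "disc_area \<Gamma>0 = cball 0 (sqrt (\<Gamma>0 / pi))"

definition cdet :: "complex \<Rightarrow> complex \<Rightarrow> real" where
  "cdet a b = Re a * Im b - Im a * Re b"

definition det3 :: "real^3 \<Rightarrow> real^3 \<Rightarrow> real^3 \<Rightarrow> real" where
  "det3 a b c =
     a$1 * (b$2 * c$3 - b$3 * c$2) - a$2 * (b$1 * c$3 - b$3 * c$1) + a$3 * (b$1 * c$2 - b$2 * c$1)"

definition e_zeta :: "real \<times> complex" where "e_zeta = (1, 0)"
definition e_x :: "real \<times> complex" where "e_x = (0, 1)"
definition e_y :: "real \<times> complex" where "e_y = (0, \<i>)"

definition nondegenerate_pressure :: "real \<Rightarrow> (complex \<Rightarrow> real) \<Rightarrow> bool" where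
  "nondegenerate_pressure \<Gamma>0 ph \<longleftrightarrow>
     smooth_near (disc_area \<Gamma>0) ph \<and>
     (\<exists>c. \<forall>q\<in>frontier (disc_area \<Gamma>0). ph q = c) \<and>
     (\<exists>!q. q \<in> disc_area \<Gamma>0 \<and> frechet_derivative ph (at q) = (\<lambda>_. 0))"

definition regular_value :: "real \<Rightarrow> (complex \<Rightarrow> real) \<Rightarrow> real \<Rightarrow> bool" where
  "regular_value \<Gamma>0 ph P0 \<longleftrightarrow>
     (\<forall>q\<in>disc_area \<Gamma>0. ph q = P0 \<longrightarrow> frechet_derivative ph (at q) \<noteq> (\<lambda>_. 0))"

(* ---------- Toroidal domain ----------
   X : R \<times> D \<rightarrow> R^3 is the inverse of the lifted coordinates (zeta,x,y), i.e. the
   universal covering map composed with the coordinate chart; zeta is an angle (period 2 pi).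
   Q = X ` (UNIV \<times> D); (zeta,x,y) : Q \<rightarrow> S^1 \<times> D is an orientation-preserving diffeomorphism. *)

definition toroidal_param :: "(real \<times> complex \<Rightarrow> real^3) \<Rightarrow> bool" where
  "toroidal_param X \<longleftrightarrow>
     smooth_near (UNIV \<times> unit_disc) X \<and>
     (\<forall>\<zeta> z. X (\<zeta> + 2 * pi, z) = X (\<zeta>, z)) \<and>
     (\<forall>\<zeta> z \<zeta>' z'. z \<in> unit_disc \<longrightarrow> z' \<in> unit_disc \<longrightarrow> X (\<zeta>, z) = X (\<zeta>', z') \<longrightarrow>
          z = z' \<and> (\<exists>k::int. \<zeta>' = \<zeta> + 2 * pi * of_int k)) \<and>
     (\<forall>\<zeta>. \<forall>z\<in>unit_disc.
          det3 (frechet_derivative X (at (\<zeta>, z)) e_zeta)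
               (frechet_derivative X (at (\<zeta>, z)) e_x)
               (frechet_derivative X (at (\<zeta>, z)) e_y) > 0)"

definition toroidal_domain :: "(real^3) set \<Rightarrow> (real \<times> complex \<Rightarrow> real^3) \<Rightarrow> bool" where
  "toroidal_domain Q X \<longleftrightarrow> toroidal_param X \<and> Q = X ` (UNIV \<times> unit_disc)"

definition Xd :: "(real \<times> complex \<Rightarrow> real^3) \<Rightarrow> real \<Rightarrow> complex \<Rightarrow> real \<times> complex \<Rightarrow> real^3" where
  "Xd X \<zeta> z v = frechet_derivative X (at (\<zeta>, z)) v"

(* h_zeta = I_zeta^* g, components *)
definition h_xx where "h_xx X \<zeta> z = Xd X \<zeta> z e_x \<bullet> Xd X \<zeta> z e_x"
definition h_xy where "h_xy X \<zeta> z = Xd X \<zeta> z e_x \<bullet> Xd X \<zeta> z e_y"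
definition h_yy where "h_yy X \<zeta> z = Xd X \<zeta> z e_y \<bullet> Xd X \<zeta> z e_y"

definition hform :: "(real \<times> complex \<Rightarrow> real^3) \<Rightarrow> real \<Rightarrow> complex \<Rightarrow> complex \<Rightarrow> complex \<Rightarrow> real" where
  "hform X \<zeta> z v w =
     h_xx X \<zeta> z * Re v * Re w + h_xy X \<zeta> z * (Re v * Im w + Im v * Re w) + h_yy X \<zeta> z * Im v * Im w"

(* flat with respect to h_zeta; a 1-form a dx + b dy is represented by the complex number a + i b,
   so that its value on a vector w is the real inner product  alpha \<bullet> w *)
definition flat :: "(real \<times> complex \<Rightarrow> real^3) \<Rightarrow> real \<Rightarrow> complex \<Rightarrow> complex \<Rightarrow> complex" where
  "flat X \<zeta> z v = Complex (h_xx X \<zeta> z * Re v + h_xy X \<zeta> z * Im v) (h_xy X \<zeta> z * Re v + h_yy X \<zeta> z * Im v)"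

(* shift vector: iota_N h = I^*(iota_{d_zeta} g), i.e. flat N = (g(d_zeta,d_x), g(d_zeta,d_y)) *)
definition shift :: "(real \<times> complex \<Rightarrow> real^3) \<Rightarrow> real \<Rightarrow> complex \<Rightarrow> complex" where
  "shift X \<zeta> z =
     (let bx = Xd X \<zeta> z e_zeta \<bullet> Xd X \<zeta> z e_x; by = Xd X \<zeta> z e_zeta \<bullet> Xd X \<zeta> z e_y;
          dh = h_xx X \<zeta> z * h_yy X \<zeta> z - (h_xy X \<zeta> z)^2
      in Complex ((h_yy X \<zeta> z * bx - h_xy X \<zeta> z * by) / dh) ((h_xx X \<zeta> z * by - h_xy X \<zeta> z * bx) / dh))"

definition lapse_sq :: "(real \<times> complex \<Rightarrow> real^3) \<Rightarrow> real \<Rightarrow> complex \<Rightarrow> real" where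
  "lapse_sq X \<zeta> z = Xd X \<zeta> z e_zeta \<bullet> Xd X \<zeta> z e_zeta - hform X \<zeta> z (shift X \<zeta> z) (shift X \<zeta> z)"

(* omega_zeta = I^*(iota_{d_zeta} Omega) = vol_dens dx\<and>dy *)
definition vol_dens :: "(real \<times> complex \<Rightarrow> real^3) \<Rightarrow> real \<Rightarrow> complex \<Rightarrow> real" where
  "vol_dens X \<zeta> z = det3 (Xd X \<zeta> z e_zeta) (Xd X \<zeta> z e_x) (Xd X \<zeta> z e_y)"

definition psid :: "(real \<Rightarrow> complex \<Rightarrow> complex) \<Rightarrow> real \<Rightarrow> complex \<Rightarrow> real \<times> complex \<Rightarrow> complex" where
  "psid \<psi> \<zeta> z v = frechet_derivative (\<lambda>(s, w). \<psi> s w) (at (\<zeta>, z)) v"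

(* rho_zeta = psi_zeta^*(dU\<and>dV) = rho_dens dx\<and>dy *)
definition rho_dens where "rho_dens \<psi> \<zeta> z = cdet (psid \<psi> \<zeta> z e_x) (psid \<psi> \<zeta> z e_y)"

definition dens_n where "dens_n X \<psi> \<zeta> z = rho_dens \<psi> \<zeta> z / vol_dens X \<zeta> z"

(* u_zeta = -[D psi_zeta]^{-1} d_zeta psi_zeta  (Cramer's rule) *)
definition vel_u :: "(real \<Rightarrow> complex \<Rightarrow> complex) \<Rightarrow> real \<Rightarrow> complex \<Rightarrow> complex" where
  "vel_u \<psi> \<zeta> z =
     Complex (- cdet (psid \<psi> \<zeta> z e_zeta) (psid \<psi> \<zeta> z e_y) / rho_dens \<psi> \<zeta> z)
             (- cdet (psid \<psi> \<zeta> z e_x) (psid \<psi> \<zeta> z e_zeta) / rho_dens \<psi> \<zeta> z)"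

definition pres :: "(complex \<Rightarrow> real) \<Rightarrow> (real \<Rightarrow> complex \<Rightarrow> complex) \<Rightarrow> real \<Rightarrow> complex \<Rightarrow> real" where
  "pres ph \<psi> \<zeta> z = ph (\<psi> \<zeta> z)"

definition momentum :: "(real \<times> complex \<Rightarrow> real^3) \<Rightarrow> (real \<Rightarrow> complex \<Rightarrow> complex) \<Rightarrow> real \<Rightarrow> complex \<Rightarrow> complex" where
  "momentum X \<psi> \<zeta> z = dens_n X \<psi> \<zeta> z *\<^sub>R flat X \<zeta> z (vel_u \<psi> \<zeta> z + shift X \<zeta> z)"

definition energy_term where
  "energy_term X \<psi> \<zeta> z =
     dens_n X \<psi> \<zeta> z * (hform X \<zeta> z (vel_u \<psi> \<zeta> z + shift X \<zeta> z) (vel_u \<psi> \<zeta> z + shift X \<zeta> z)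
                         + lapse_sq X \<zeta> z)"

definition diffeo_path :: "real \<Rightarrow> real set \<Rightarrow> (real \<Rightarrow> complex \<Rightarrow> complex) \<Rightarrow> bool" where
  "diffeo_path \<Gamma>0 J \<psi> \<longleftrightarrow>
     smooth_near (J \<times> unit_disc) (\<lambda>(s, w). \<psi> s w) \<and>
     (\<forall>\<zeta>\<in>J. bij_betw (\<psi> \<zeta>) unit_disc (disc_area \<Gamma>0) \<and>
              (\<forall>z\<in>unit_disc. rho_dens \<psi> \<zeta> z \<noteq> 0))"

(* Euler-Lagrange equations of S_phat at (zeta, z):
   (d_zeta + L_u)(pi) = dp/n + d(n(|u+N|^2 + N^2)),  tested on the directions d_x, d_y.
   (L_u alpha)_i = u^j d_j alpha_i + alpha_j d_i u^j. *)
definition EL_eq :: "(real \<times> complex \<Rightarrow> real^3) \<Rightarrow> (complex \<Rightarrow> real) \<Rightarrow> (real \<Rightarrow> complex \<Rightarrow> complex) \<Rightarrow> real \<Rightarrow> complex \<Rightarrow> bool" where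
  "EL_eq X ph \<psi> \<zeta> z \<longleftrightarrow>
     (\<forall>e\<in>{1, \<i>}.
        (frechet_derivative (\<lambda>(s, w). momentum X \<psi> s w) (at (\<zeta>, z)) e_zeta
         + frechet_derivative (\<lambda>(s, w). momentum X \<psi> s w) (at (\<zeta>, z)) (0, vel_u \<psi> \<zeta> z)) \<bullet> e
        + momentum X \<psi> \<zeta> z \<bullet> frechet_derivative (\<lambda>(s, w). vel_u \<psi> s w) (at (\<zeta>, z)) (0, e)
      = frechet_derivative (\<lambda>(s, w). pres ph \<psi> s w) (at (\<zeta>, z)) (0, e) / dens_n X \<psi> \<zeta> z
        + frechet_derivative (\<lambda>(s, w). energy_term X \<psi> s w) (at (\<zeta>, z)) (0, e))"

definition isobar :: "(complex \<Rightarrow> real) \<Rightarrow> (real \<Rightarrow> complex \<Rightarrow> complex) \<Rightarrow> real \<Rightarrow> real \<Rightarrow> complex set" where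
  "isobar ph \<psi> \<zeta> P0 = {z \<in> unit_disc. pres ph \<psi> \<zeta> z = P0}"

(* gamma parametrises the closed curve c once, oriented as the boundary of the disc it
   encloses (winding number +1 around the enclosed points) *)
definition pos_oriented_param :: "complex set \<Rightarrow> (real \<Rightarrow> complex) \<Rightarrow> bool" where
  "pos_oriented_param c \<gamma> \<longleftrightarrow>
     valid_path \<gamma> \<and> simple_path \<gamma> \<and> pathfinish \<gamma> = pathstart \<gamma> \<and> path_image \<gamma> = c \<and>
     (\<exists>w. w \<notin> c \<and> winding_number \<gamma> w = 1)"

definition line_int :: "(complex \<Rightarrow> complex) \<Rightarrow> (real \<Rightarrow> complex) \<Rightarrow> real" where
  "line_int \<alpha> \<gamma> = integral {0..1} (\<lambda>t. \<alpha> (\<gamma> t) \<bullet> vector_derivative \<gamma> (at t))"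

end

theory Submission
  imports Defs
begin

text \<open>
  Fix the image \<open>\<sigma>\<close> in the reference disc of the isobar at \<open>\<zeta>1\<close> and pull it back to the loops
  \<open>\<Gamma>\<^sub>\<zeta> = \<psi>\<^sub>\<zeta>\<^sup>-\<^sup>1 \<circ> \<sigma>\<close>, which trace the isobars of \<open>p\<^sub>\<zeta>\<close> and move with velocity \<open>u\<^sub>\<zeta>\<close>. The Euler-Lagrange
  equations say that \<open>\<Gamma>\<^sub>\<zeta>\<^sup>* \<pi>\<^sub>\<zeta>\<close> changes at the rate \<open>\<Gamma>\<^sub>\<zeta>\<^sup>* (dp\<^sub>\<zeta> / n\<^sub>\<zeta> + dE\<^sub>\<zeta>)\<close>; the first term vanishes
  because \<open>p\<^sub>\<zeta>\<close> is constant along \<open>\<Gamma>\<^sub>\<zeta>\<close>, the second is exact, so the circulation is conserved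
  as in Kelvin's theorem. The loop obtained at \<open>\<zeta>2\<close> winds once around the transported point, by
  homotopy invariance of the winding number; and the circulation around a regular level curve depends
  only on its orientation, since two simple closed parametrizations differ by a monotone change of
  parameter and every 1-form has a primitive along a short regular arc.
\<close>

section \<open>Line integrals along regular level curves\<close>

lemma loop_reparametrization:
  fixes \<gamma> \<delta> :: "real \<Rightarrow> 'a::metric_space"
  assumes \<gamma>: "simple_path \<gamma>" "pathfinish \<gamma> = pathstart \<gamma>"
    and \<delta>: "simple_path \<delta>" "pathfinish \<delta> = pathstart \<delta>"
    and img: "path_image \<gamma> = path_image \<delta>" and start: "pathstart \<gamma> = pathstart \<delta>"
  obtains k where "continuous_on {0..1} k" "strict_mono_on {0..1} k" "k 0 = 0" "k 1 = (1::real)"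
    "(\<forall>t\<in>{0..1}. \<delta> t = \<gamma> (k t)) \<or> (\<forall>t\<in>{0..1}. reversepath \<delta> t = \<gamma> (k t))"
proof -
  note result = that
  define I :: "real set" where "I = {0<..<1}"
  have ends: "\<gamma> 0 = \<delta> 0" "\<gamma> 1 = \<delta> 0" "\<delta> 1 = \<delta> 0"
    using assms by (auto simp: pathstart_def pathfinish_def)
  have inj: "inj_on \<gamma> I" "inj_on \<delta> I"
    using simple_path_inj_on[OF \<gamma>(1)] simple_path_inj_on[OF \<delta>(1)] by (auto simp: I_def)
  have ne: "\<gamma> t \<noteq> \<delta> 0 \<and> \<delta> t \<noteq> \<delta> 0" if "t \<in> I" for t
  proof -
    have "\<gamma> t \<noteq> \<gamma> 0"
      using \<gamma>(1) that unfolding simple_path_def loop_free_def I_def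
      by (metis atLeastAtMost_iff greaterThanLessThan_iff less_irrefl less_imp_le order_refl zero_le_one)
    moreover have "\<delta> t \<noteq> \<delta> 0"
      using \<delta>(1) that unfolding simple_path_def loop_free_def I_def
      by (metis atLeastAtMost_iff greaterThanLessThan_iff less_irrefl less_imp_le order_refl zero_le_one)
    ultimately show ?thesis using ends by simp
  qed
  have I01: "{0..1} = insert 0 (insert 1 I)"
    by (auto simp: I_def)
  have open_image: "\<gamma> ` I = \<delta> ` I"
  proof -
    have "\<gamma> ` I = path_image \<gamma> - {\<delta> 0}" "\<delta> ` I = path_image \<delta> - {\<delta> 0}"
      using ne ends by (auto simp: path_image_def I01)
    then show ?thesis using img by simp
  qed
  have cont: "continuous_on {0..1} \<gamma>" "continuous_on {0..1} \<delta>"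
    using \<gamma>(1) \<delta>(1) by (auto simp: simple_path_def path_def)
  define j where "j = (\<lambda>t. inv_into I \<gamma> (\<delta> t))"
  have jI: "j t \<in> I" and \<gamma>j: "\<gamma> (j t) = \<delta> t" if "t \<in> I" for t
  proof -
    have "\<delta> t \<in> \<gamma> ` I" using that open_image by auto
    then show "j t \<in> I" "\<gamma> (j t) = \<delta> t" unfolding j_def by (auto simp: inv_into_into f_inv_into_f)
  qed
  have surj: "\<exists>s\<in>I. j s = t" if "t \<in> I" for t
  proof -
    have "\<gamma> t \<in> \<delta> ` I" using that open_image by auto
    then obtain s where "s \<in> I" "\<delta> s = \<gamma> t" by auto
    then show ?thesis using that inj(1) by (auto simp: j_def intro!: bexI[of _ s])
  qed
  have inj_j: "inj_on j I"
  proof (rule inj_onI)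
    fix x y assume xy: "x \<in> I" "y \<in> I" "j x = j y"
    then have "\<delta> x = \<delta> y" using \<gamma>j by metis
    then show "x = y" using inj(2) xy by (simp add: inj_on_eq_iff)
  qed
  have "continuous_on I j"
  proof (rule continuous_at_imp_continuous_on, rule ballI)
    fix s assume s: "s \<in> I"
    define a b where "a = s/2" and "b = (1 + s)/2"
    have ab: "0 < a" "a < s" "s < b" "b < 1" using s by (auto simp: a_def b_def I_def field_simps)
    then have sub: "{a..b} \<subseteq> I" by (auto simp: I_def)
    define K where "K = {0..1} \<inter> \<gamma> -` (\<delta> ` {a..b})"
    have "compact (\<delta> ` {a..b})"
      by (intro compact_continuous_image continuous_on_subset[OF cont(2)]) (use ab in auto)
    then have "closed K"
      unfolding K_def by (intro continuous_closed_preimage cont compact_imp_closed) auto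
    then have "compact K"
      using bounded_subset[OF bounded_closed_interval, of K 0 1] by (auto simp: compact_eq_bounded_closed K_def)
    have KI: "K \<subseteq> I"
    proof
      fix t assume t: "t \<in> K"
      then obtain r where r: "r \<in> {a..b}" "\<gamma> t = \<delta> r" by (auto simp: K_def)
      then have "\<gamma> t \<noteq> \<delta> 0" using ne sub by auto
      then show "t \<in> I" using t ends I01 by (auto simp: K_def)
    qed
    have "continuous_on (\<gamma> ` K) (inv_into I \<gamma>)"
    proof (rule continuous_on_inv[OF _ \<open>compact K\<close>])
      show "continuous_on K \<gamma>" using cont(1) by (rule continuous_on_subset) (auto simp: K_def)
      show "\<forall>x\<in>K. inv_into I \<gamma> (\<gamma> x) = x" using KI inj(1) by auto
    qed
    moreover have "\<delta> ` {a..b} \<subseteq> \<gamma> ` K"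
    proof
      fix z assume "z \<in> \<delta> ` {a..b}"
      then obtain r where r: "r \<in> {a..b}" "z = \<delta> r" by auto
      then have "\<gamma> (j r) = z" "j r \<in> I" using sub \<gamma>j jI by auto
      then show "z \<in> \<gamma> ` K" using r I01 by (auto simp: K_def intro!: image_eqI[of _ _ "j r"])
    qed
    ultimately have "continuous_on {a..b} j"
      unfolding j_def
      by (intro continuous_on_compose2[of "\<gamma> ` K" "inv_into I \<gamma>" "{a..b}" \<delta>] continuous_on_subset[OF cont(2)])
        (use ab in auto)
    then show "isCont j s"
      using ab by (auto intro: continuous_on_interior)
  qed
  then have dich: "strict_mono_on I j \<or> strict_antimono_on I j"
    using injective_eq_monotone_map[of I j] inj_j by (simp add: I_def is_interval_oo)
  have extend: thesis
    if h: "strict_mono_on I h" "\<And>t. t \<in> I \<Longrightarrow> h t \<in> I" "\<And>t. t \<in> I \<Longrightarrow> \<exists>s\<in>I. h s = t"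
      and h\<delta>: "(\<forall>t\<in>I. \<delta> t = \<gamma> (h t)) \<or> (\<forall>t\<in>I. reversepath \<delta> t = \<gamma> (h t))" for h
  proof -
    define k where "k = (\<lambda>t. if t \<in> I then h t else t)"
    have sm: "k x < k y" if "x < y" for x y
      using h(2)[of x] h(2)[of y] strict_mono_onD[OF h(1), of x y] that
      by (auto simp: k_def I_def split: if_splits)
    have "surj k"
    proof -
      have "\<exists>x. y = k x" for y
      proof (cases "y \<in> I")
        case True
        then obtain s where "s \<in> I" "h s = y" using h(3) by blast
        then show ?thesis by (intro exI[of _ s]) (simp add: k_def)
      qed (auto simp: k_def intro!: exI[of _ y])
      then show ?thesis by (simp add: surj_def)
    qed
    then have "continuous_on UNIV k"
    proof (intro continuous_onI_mono)
      show "k x \<le> k y" if "x \<le> y" for x y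
        using sm[of x y] that by (cases "x = y") auto
    qed auto
    then have "continuous_on {0..1} k" by (rule continuous_on_subset) auto
    moreover have "strict_mono_on {0..1} k" by (auto simp: strict_mono_on_def sm)
    moreover have "k 0 = 0" "k 1 = 1" by (auto simp: k_def I_def)
    moreover have "(\<forall>t\<in>{0..1}. \<delta> t = \<gamma> (k t)) \<or> (\<forall>t\<in>{0..1}. reversepath \<delta> t = \<gamma> (k t))"
      using h\<delta>
    proof
      assume "\<forall>t\<in>I. \<delta> t = \<gamma> (h t)"
      then show ?thesis using ends unfolding I01 by (auto simp: k_def)
    next
      assume "\<forall>t\<in>I. reversepath \<delta> t = \<gamma> (h t)"
      then show ?thesis using ends unfolding I01 by (auto simp: k_def reversepath_def)
    qed
    ultimately show thesis by (rule result)
  qed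
  have I_flip: "1 - t \<in> I \<longleftrightarrow> t \<in> I" for t by (auto simp: I_def)
  from dich show thesis
  proof
    assume "strict_mono_on I j"
    then show thesis by (rule extend) (use jI \<gamma>j surj in auto)
  next
    assume *: "strict_antimono_on I j"
    show thesis
    proof (rule extend[of "\<lambda>t. j (1 - t)"])
      show "strict_mono_on I (\<lambda>t. j (1 - t))"
        using * I_flip by (auto simp: strict_mono_on_def monotone_on_def)
      show "\<exists>s\<in>I. j (1 - s) = t" if "t \<in> I" for t
      proof -
        obtain s where "s \<in> I" "j s = t" using surj[OF \<open>t \<in> I\<close>] by blast
        then show ?thesis using I_flip[of s] by (intro bexI[of _ "1 - s"]) auto
      qed
    qed (use jI \<gamma>j I_flip in \<open>auto simp: reversepath_def\<close>)
  qed
qed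

lemma has_integral_along_graph:
  fixes \<gamma> :: "real \<Rightarrow> complex" and P :: "real \<Rightarrow> complex"
  assumes P: "\<And>x. x \<in> R \<Longrightarrow> (P has_vector_derivative q x) (at x within R)"
    and ab: "a \<le> b" and cont: "continuous_on {a..b} \<gamma>"
    and S: "finite S" "\<And>t. t \<in> {a<..<b} - S \<Longrightarrow> (\<gamma> has_vector_derivative \<gamma>' t) (at t)"
    and tangent: "\<And>t. t \<in> {a<..<b} - S \<Longrightarrow> \<gamma>' t = (\<tau> \<bullet> \<gamma>' t) *\<^sub>R m (\<gamma> t)"
    and range: "\<And>t. t \<in> {a..b} \<Longrightarrow> \<tau> \<bullet> \<gamma> t \<in> R \<and> q (\<tau> \<bullet> \<gamma> t) = f (\<gamma> t) * m (\<gamma> t)"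
  shows "((\<lambda>t. f (\<gamma> t) * \<gamma>' t) has_integral (P (\<tau> \<bullet> \<gamma> b) - P (\<tau> \<bullet> \<gamma> a))) {a..b}"
proof -
  let ?X = "\<lambda>t. \<tau> \<bullet> \<gamma> t"
  have "continuous_on R P"
    unfolding continuous_on_eq_continuous_within by (blast intro: P has_vector_derivative_continuous)
  then have 1: "continuous_on {a..b} (\<lambda>t. P (?X t))"
    by (rule continuous_on_compose2) (use range in \<open>auto intro!: continuous_intros cont\<close>)
  have 2: "((\<lambda>t. P (?X t)) has_vector_derivative f (\<gamma> t) * \<gamma>' t) (at t)" if t: "t \<in> {a<..<b} - S" for t
  proof -
    have X': "(?X has_vector_derivative \<tau> \<bullet> \<gamma>' t) (at t within {a<..<b})"
      by (intro bounded_linear.has_vector_derivative[OF bounded_linear_inner_right]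
          has_vector_derivative_at_within[OF S(2)] t)
    have "(P has_vector_derivative q (?X t)) (at (?X t) within ?X ` {a<..<b})"
      by (rule has_vector_derivative_within_subset[OF P]) (use range t in auto)
    from vector_diff_chain_within[OF X' this]
    have "((\<lambda>t. P (?X t)) has_vector_derivative (\<tau> \<bullet> \<gamma>' t) *\<^sub>R q (?X t)) (at t within {a<..<b})"
      by (simp add: o_def)
    moreover have "(\<tau> \<bullet> \<gamma>' t) *\<^sub>R q (?X t) = f (\<gamma> t) * ((\<tau> \<bullet> \<gamma>' t) *\<^sub>R m (\<gamma> t))"
      using range[of t] t by simp
    ultimately show ?thesis
      using tangent[OF t] t by (simp add: at_within_open[of t "{a<..<b}"])
  qed
  show ?thesis
    using fundamental_theorem_of_calculus_interior_strong[OF S(1) ab 2 1] by simp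
qed

text \<open>
  Two obstacles rule out an ordinary substitution here: a \<^const>\<open>valid_path\<close> may have an unbounded
  derivative near its exceptional points, so integrability is part of the claim, and \<open>k\<close> need not be
  differentiable where the derivative of \<open>\<gamma>\<close> vanishes. Both disappear on writing each integrand as the
  derivative of one primitive in the coordinate \<open>\<tau> \<bullet> z\<close>, which the two curves share.
\<close>

lemma has_integral_reparametrized_graph:
  fixes \<gamma> \<delta> :: "real \<Rightarrow> complex"
  assumes ab: "a \<le> b"
    and \<delta>: "continuous_on {a..b} \<delta>" "finite S" "\<And>t. t \<in> {a<..<b} - S \<Longrightarrow> (\<delta> has_vector_derivative \<delta>' t) (at t)"
       "\<And>t. t \<in> {a<..<b} - S \<Longrightarrow> \<delta>' t = (\<tau> \<bullet> \<delta>' t) *\<^sub>R m (\<delta> t)"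
    and \<gamma>: "continuous_on {k a..k b} \<gamma>" "finite T" "\<And>t. t \<in> {k a<..<k b} - T \<Longrightarrow> (\<gamma> has_vector_derivative \<gamma>' t) (at t)"
       "\<And>t. t \<in> {k a<..<k b} - T \<Longrightarrow> \<gamma>' t = (\<tau> \<bullet> \<gamma>' t) *\<^sub>R m (\<gamma> t)"
    and k: "continuous_on {a..b} k" "k a \<le> k b" "\<And>t. t \<in> {a..b} \<Longrightarrow> \<delta> t = \<gamma> (k t)"
    and inj: "inj_on (\<lambda>t. \<tau> \<bullet> \<delta> t) {a..b}"
    and f: "continuous_on (\<delta> ` {a..b}) (\<lambda>z. f z * m z)"
  shows "\<exists>I. ((\<lambda>t. f (\<delta> t) * \<delta>' t) has_integral I) {a..b} \<and> ((\<lambda>t. f (\<gamma> t) * \<gamma>' t) has_integral I) {k a..k b}"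
proof -
  define X where "X = (\<lambda>t. \<tau> \<bullet> \<delta> t)"
  define g where "g = inv_into {a..b} X"
  have contX: "continuous_on {a..b} X" unfolding X_def by (intro continuous_intros \<delta>)
  have gX: "g (X t) = t" if "t \<in> {a..b}" for t
    using inj that unfolding g_def X_def[symmetric] by simp
  have contg: "continuous_on (X ` {a..b}) g"
    by (rule continuous_on_inv[OF contX compact_Icc]) (use gX in auto)
  define q where "q = (\<lambda>x. f (\<delta> (g x)) * m (\<delta> (g x)))"
  have contq: "continuous_on (X ` {a..b}) q"
    unfolding q_def
    by (rule continuous_on_compose2[OF f continuous_on_compose2[OF \<delta>(1) contg]]) (use gX in auto)
  obtain c d where cd: "X ` {a..b} = {c..d}"
    using contX ab by (metis continuous_image_closed_interval)
  obtain P where P: "\<And>x. x \<in> X ` {a..b} \<Longrightarrow> (P has_vector_derivative q x) (at x within X ` {a..b})"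
    using antiderivative_continuous[of c d q] contq cd by metis
  have 1: "((\<lambda>t. f (\<delta> t) * \<delta>' t) has_integral (P (\<tau> \<bullet> \<delta> b) - P (\<tau> \<bullet> \<delta> a))) {a..b}"
    by (rule has_integral_along_graph[OF P ab \<delta>]) (auto simp: q_def gX X_def[symmetric] gX[unfolded X_def] fun_cong[OF X_def])
  have 2: "((\<lambda>t. f (\<gamma> t) * \<gamma>' t) has_integral (P (\<tau> \<bullet> \<gamma> (k b)) - P (\<tau> \<bullet> \<gamma> (k a)))) {k a..k b}"
  proof (rule has_integral_along_graph[OF P k(2) \<gamma>])
    fix t assume t: "t \<in> {k a..k b}"
    then obtain s where s: "s \<in> {a..b}" "k s = t"
      using IVT'[of k a t b] k(1) ab by auto
    then have "\<gamma> t = \<delta> s" using k(3) by simp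
    then show "\<tau> \<bullet> \<gamma> t \<in> X ` {a..b} \<and> q (\<tau> \<bullet> \<gamma> t) = f (\<gamma> t) * m (\<gamma> t)"
      using s gX[OF s(1)] by (auto simp: q_def X_def)
  qed
  have "\<gamma> (k a) = \<delta> a" "\<gamma> (k b) = \<delta> b" using k(3) ab by auto
  then show ?thesis using 1 2 by auto
qed

lemma level_set_local_graph:
  fixes p :: "complex \<Rightarrow> real" and G :: "complex \<Rightarrow> complex"
  assumes U: "open U" "c \<subseteq> U" and p: "\<And>z. z \<in> U \<Longrightarrow> (p has_derivative (\<lambda>v. G z \<bullet> v)) (at z)"
    and G: "continuous_on U G" and level: "\<And>z. z \<in> c \<Longrightarrow> p z = P0"
    and c0: "c0 \<in> c" "G c0 \<noteq> 0"
  obtains \<tau> m r where "r > 0" "inj_on (\<lambda>z. \<tau> \<bullet> z) (c \<inter> ball c0 r)" "continuous_on (c \<inter> ball c0 r) m"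
    "\<And>z v. z \<in> c \<inter> ball c0 r \<Longrightarrow> G z \<bullet> v = 0 \<Longrightarrow> v = (\<tau> \<bullet> v) *\<^sub>R m z"
proof -
  define \<tau> where "\<tau> = \<i> * G c0"
  \<comment> \<open>\<open>\<tau>\<close> is tangent at \<open>c0\<close>, and \<open>m z\<close> is tangent at \<open>z\<close>, scaled to have \<open>\<tau>\<close>-component 1.\<close>
  define m where "m = (\<lambda>z. (1 / (G c0 \<bullet> G z)) *\<^sub>R (\<i> * G z))"
  have "open {z \<in> U. G c0 \<bullet> G z > 0}"
  proof -
    have "continuous_on U (\<lambda>z. G c0 \<bullet> G z)" by (intro continuous_intros G)
    from continuous_open_preimage[OF this U(1), of "{0<..}"] show ?thesis
      by (simp add: vimage_def Int_def)
  qed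
  moreover have "c0 \<in> {z \<in> U. G c0 \<bullet> G z > 0}" using c0 U by auto
  ultimately obtain r where r: "r > 0" "ball c0 r \<subseteq> {z \<in> U. G c0 \<bullet> G z > 0}"
    using open_contains_ball by blast
  have "continuous_on (c \<inter> ball c0 r) m"
    unfolding m_def
    by (intro continuous_intros continuous_on_subset[OF G]) (use r in auto)
  moreover have "v = (\<tau> \<bullet> v) *\<^sub>R m z" if z: "z \<in> c \<inter> ball c0 r" and v: "G z \<bullet> v = 0" for z v
  proof -
    have pos: "G c0 \<bullet> G z > 0" using r z by auto
    have "Re (G z) * Re v + Im (G z) * Im v = 0" using v by (simp add: inner_complex_def)
    then have "(G c0 \<bullet> G z) * Re v = (\<tau> \<bullet> v) * Re (\<i> * G z)" "(G c0 \<bullet> G z) * Im v = (\<tau> \<bullet> v) * Im (\<i> * G z)"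
      unfolding \<tau>_def inner_complex_def by (simp, algebra)+
    then show ?thesis
      using pos by (auto simp: m_def complex_eq_iff field_simps)
  qed
  moreover have "inj_on (\<lambda>z. \<tau> \<bullet> z) (c \<inter> ball c0 r)"
  proof (rule inj_onI, rule ccontr)
    fix y z assume y: "y \<in> c \<inter> ball c0 r" and z: "z \<in> c \<inter> ball c0 r" and eq: "\<tau> \<bullet> y = \<tau> \<bullet> z" and ne: "y \<noteq> z"
    have seg: "closed_segment y z \<subseteq> ball c0 r"
      using y z by (intro closed_segment_subset) auto
    have "\<exists>x\<in>{0<..<1::real}. p (y + 1 *\<^sub>R (z - y)) - p (y + 0 *\<^sub>R (z - y)) = (\<lambda>h. G (y + x *\<^sub>R (z - y)) \<bullet> (h *\<^sub>R (z - y))) (1 - 0)"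
    proof (rule mvt_simple)
      fix x :: real assume x: "0 \<le> x" "x \<le> 1"
      have "y + x *\<^sub>R (z - y) \<in> closed_segment y z"
        using x by (auto simp: closed_segment_def algebra_simps intro!: exI[of _ x])
      then have "y + x *\<^sub>R (z - y) \<in> U" using seg r by auto
      from p[OF this] show "((\<lambda>x. p (y + x *\<^sub>R (z - y))) has_derivative (\<lambda>h. G (y + x *\<^sub>R (z - y)) \<bullet> (h *\<^sub>R (z - y)))) (at x within {0..1})"
        by (rule has_derivative_compose[rotated]) (auto intro!: derivative_eq_intros)
    qed simp
    then obtain x where x: "0 < x" "x < 1" "G (y + x *\<^sub>R (z - y)) \<bullet> (z - y) = 0"
      using level y z by auto
    define w where "w = y + x *\<^sub>R (z - y)"
    have "w \<in> closed_segment y z"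
      using x by (auto simp: w_def closed_segment_def algebra_simps intro!: exI[of _ x])
    then have pos: "G c0 \<bullet> G w > 0" using seg r by auto
    define v where "v = z - y"
    have 1: "Re (G w) * Re v + Im (G w) * Im v = 0" using x by (simp add: w_def v_def inner_complex_def)
    have "\<tau> \<bullet> v = 0" using eq by (simp add: v_def inner_diff_right)
    then have 2: "- Im (G c0) * Re v + Re (G c0) * Im v = 0" by (simp add: \<tau>_def inner_complex_def)
    have "(G c0 \<bullet> G w) * Re v = 0" "(G c0 \<bullet> G w) * Im v = 0"
      using 1 2 unfolding inner_complex_def by algebra+
    then have "v = 0" using pos by (simp add: complex_eq_iff)
    then show False using ne by (simp add: v_def)
  qed
  ultimately show thesis using that r(1) by blast
qed

lemma has_contour_integral_reparametrized_level_curve: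
  fixes p :: "complex \<Rightarrow> real" and G :: "complex \<Rightarrow> complex"
  assumes U: "open U" "c \<subseteq> U" and p: "\<And>z. z \<in> U \<Longrightarrow> (p has_derivative (\<lambda>v. G z \<bullet> v)) (at z)"
    and G: "continuous_on U G" and level: "\<And>z. z \<in> c \<Longrightarrow> p z = P0"
    and regular: "\<And>z. z \<in> c \<Longrightarrow> G z \<noteq> 0"
    and \<gamma>: "valid_path \<gamma>" "path_image \<gamma> \<subseteq> c"
    and \<delta>: "valid_path \<delta>" "simple_path \<delta>" "path_image \<delta> \<subseteq> c"
    and k: "continuous_on {0..1} k" "strict_mono_on {0..1} k" "k 0 = 0" "k 1 = 1"
      "\<And>t. t \<in> {0..1} \<Longrightarrow> \<delta> t = \<gamma> (k t)"
    and f: "continuous_on c f"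
  shows "\<exists>I. (f has_contour_integral I) \<delta> \<and> (f has_contour_integral I) \<gamma>"
proof -
  define \<gamma>' \<delta>' where "\<gamma>' = (\<lambda>t. vector_derivative \<gamma> (at t))" and "\<delta>' = (\<lambda>t. vector_derivative \<delta> (at t))"
  obtain T where T: "finite T" "\<gamma> C1_differentiable_on {0..1} - T" and cont\<gamma>: "continuous_on {0..1} \<gamma>"
    using \<gamma> by (auto simp: valid_path_def piecewise_C1_differentiable_on_def)
  obtain S where S: "finite S" "\<delta> C1_differentiable_on {0..1} - S" and cont\<delta>: "continuous_on {0..1} \<delta>"
    using \<delta> by (auto simp: valid_path_def piecewise_C1_differentiable_on_def)
  have d\<gamma>: "(\<gamma> has_vector_derivative \<gamma>' t) (at t)" if "t \<in> {0<..<1} - T" for t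
    using T(2) that unfolding C1_differentiable_on_eq \<gamma>'_def by (auto simp: vector_derivative_works)
  have d\<delta>: "(\<delta> has_vector_derivative \<delta>' t) (at t)" if "t \<in> {0<..<1} - S" for t
    using S(2) that unfolding C1_differentiable_on_eq \<delta>'_def by (auto simp: vector_derivative_works)
  have tangent: "G (g t) \<bullet> v = 0"
    if "(g has_vector_derivative v) (at t)" "t \<in> {0<..<1}" "path_image g \<subseteq> c" for g v and t :: real
  proof -
    have gc: "g s \<in> c" if "s \<in> {0<..<1}" for s
      using that \<open>path_image g \<subseteq> c\<close> by (force simp: path_image_def)
    have "((\<lambda>s. p (g s)) has_derivative (\<lambda>h. G (g t) \<bullet> (h *\<^sub>R v))) (at t)"
      by (rule has_derivative_compose[OF _ p])
        (use that gc U in \<open>auto simp: has_vector_derivative_def\<close>)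
    moreover have "((\<lambda>s. p (g s)) has_derivative (\<lambda>h. 0)) (at t)"
      by (rule has_derivative_transform_within_open[of "\<lambda>_. P0" _ t UNIV "{0<..<1}"])
        (use that gc level in auto)
    ultimately have "(\<lambda>h. G (g t) \<bullet> (h *\<^sub>R v)) = (\<lambda>h. 0)"
      by (rule has_derivative_unique)
    from fun_cong[OF this, of 1] show ?thesis by simp
  qed
  have k01: "k t \<in> {0..1}" if "t \<in> {0..1}" for t
    using strict_mono_on_leD[OF k(2), of 0 t] strict_mono_on_leD[OF k(2), of t 1] that k(3,4) by auto
  define Q where "Q = (\<lambda>a b. 0 \<le> a \<longrightarrow> b \<le> 1 \<longrightarrow>
     (\<exists>I. ((\<lambda>t. f (\<delta> t) * \<delta>' t) has_integral I) {a..b} \<and> ((\<lambda>t. f (\<gamma> t) * \<gamma>' t) has_integral I) {k a..k b}))"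
  have "(0::real) \<le> 1" by simp
  then have "Q 0 1"
  proof (induction rule: Bolzano)
    case (trans a b c)
    show ?case
      unfolding Q_def
    proof (intro impI)
      assume "0 \<le> a" "c \<le> 1"
      with trans obtain I J where
        I: "((\<lambda>t. f (\<delta> t) * \<delta>' t) has_integral I) {a..b}" "((\<lambda>t. f (\<gamma> t) * \<gamma>' t) has_integral I) {k a..k b}"
        and J: "((\<lambda>t. f (\<delta> t) * \<delta>' t) has_integral J) {b..c}" "((\<lambda>t. f (\<gamma> t) * \<gamma>' t) has_integral J) {k b..k c}"
        unfolding Q_def by fastforce
      have "k a \<le> k b" "k b \<le> k c"
        using strict_mono_on_leD[OF k(2)] trans \<open>0 \<le> a\<close> \<open>c \<le> 1\<close> by auto
      then show "\<exists>I. ((\<lambda>t. f (\<delta> t) * \<delta>' t) has_integral I) {a..c} \<and> ((\<lambda>t. f (\<gamma> t) * \<gamma>' t) has_integral I) {k a..k c}"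
        using has_integral_combine[OF _ _ I(1) J(1)] has_integral_combine[OF _ _ I(2) J(2)] trans by blast
    qed
  next
    case (local s)
    then have s01: "s \<in> {0..1}" by simp
    then have c0: "\<delta> s \<in> c" using \<delta>(3) by (auto simp: path_image_def)
    obtain \<tau> m r where r: "r > 0" and inj: "inj_on (\<lambda>z. \<tau> \<bullet> z) (c \<inter> ball (\<delta> s) r)"
      and m: "continuous_on (c \<inter> ball (\<delta> s) r) m"
      and slope: "\<And>z v. z \<in> c \<inter> ball (\<delta> s) r \<Longrightarrow> G z \<bullet> v = 0 \<Longrightarrow> v = (\<tau> \<bullet> v) *\<^sub>R m z"
      using level_set_local_graph[OF U p G level c0 regular[OF c0]] by metis
    obtain e where e: "e > 0" "\<And>t. t \<in> {0..1} \<Longrightarrow> \<bar>t - s\<bar> < e \<Longrightarrow> dist (\<delta> t) (\<delta> s) < r"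
      using cont\<delta> s01 r unfolding continuous_on_iff dist_real_def by metis
    have "Q a b" if ab: "a \<le> s" "s \<le> b" "b - a < min e 1" for a b
      unfolding Q_def
    proof (intro impI)
      assume a0: "0 \<le> a" and b1: "b \<le> 1"
      have sub: "{a..b} \<subseteq> {0..1}" using a0 b1 by auto
      have near: "\<delta> t \<in> c \<inter> ball (\<delta> s) r" if t: "t \<in> {a..b}" for t
      proof -
        have "\<bar>t - s\<bar> < e" using t ab by auto
        then show ?thesis using e(2)[of t] sub t \<delta>(3) by (auto simp: path_image_def dist_commute)
      qed
      have kab: "k a \<le> k b" "{k a..k b} \<subseteq> {0..1}"
        using strict_mono_on_leD[OF k(2), of a b] k01[of a] k01[of b] ab a0 b1 by auto
      have near\<gamma>: "\<gamma> t \<in> c \<inter> ball (\<delta> s) r" if t: "t \<in> {k a..k b}" for t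
      proof -
        obtain x where "x \<in> {a..b}" "k x = t"
          using IVT'[of k a t b] t continuous_on_subset[OF k(1) sub] ab by auto
        then show ?thesis using near[of x] k(5)[of x] sub by auto
      qed
      show "\<exists>I. ((\<lambda>t. f (\<delta> t) * \<delta>' t) has_integral I) {a..b} \<and> ((\<lambda>t. f (\<gamma> t) * \<gamma>' t) has_integral I) {k a..k b}"
      proof (rule has_integral_reparametrized_graph[where \<tau>=\<tau> and m=m and S=S and T=T and k=k and f=f and \<gamma>=\<gamma> and \<delta>=\<delta> and \<gamma>'=\<gamma>' and \<delta>'=\<delta>'])
        show "a \<le> b" using ab by simp
        show "continuous_on {a..b} \<delta>" "continuous_on {k a..k b} \<gamma>" "continuous_on {a..b} k"
          using cont\<delta> cont\<gamma> k(1) sub kab by (auto intro: continuous_on_subset)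
        show "(\<delta> has_vector_derivative \<delta>' t) (at t)" if "t \<in> {a<..<b} - S" for t
          using that a0 b1 by (intro d\<delta>) auto
        then show "\<delta>' t = (\<tau> \<bullet> \<delta>' t) *\<^sub>R m (\<delta> t)" if "t \<in> {a<..<b} - S" for t
          using that a0 b1 near[of t] by (intro slope tangent \<delta>) auto
        show "(\<gamma> has_vector_derivative \<gamma>' t) (at t)" if "t \<in> {k a<..<k b} - T" for t
          using that kab by (intro d\<gamma>) auto
        then show "\<gamma>' t = (\<tau> \<bullet> \<gamma>' t) *\<^sub>R m (\<gamma> t)" if "t \<in> {k a<..<k b} - T" for t
          using that kab near\<gamma>[of t] by (intro slope tangent \<gamma>) auto
        have "inj_on \<delta> {a..b}"
        proof (rule inj_onI)
          fix x y assume "x \<in> {a..b}" "y \<in> {a..b}" "\<delta> x = \<delta> y"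
          then show "x = y" using \<delta>(2) ab sub unfolding simple_path_def loop_free_def by force
        qed
        then show "inj_on (\<lambda>t. \<tau> \<bullet> \<delta> t) {a..b}"
          using inj near unfolding inj_on_def by blast
        show "continuous_on (\<delta> ` {a..b}) (\<lambda>z. f z * m z)"
          by (intro continuous_intros continuous_on_subset[OF f] continuous_on_subset[OF m]) (use near in auto)
      qed (use S T kab k(5) sub in auto)
    qed
    then show ?case using e(1) by (intro exI[of _ "min e 1"]) auto
  qed
  then show ?thesis
    using k(3,4) by (auto simp: Q_def has_contour_integral \<gamma>'_def \<delta>'_def)
qed

lemma contour_integral_level_curve_unique:
  fixes p :: "complex \<Rightarrow> real" and G :: "complex \<Rightarrow> complex"
  assumes U: "open U" "c \<subseteq> U" and p: "\<And>z. z \<in> U \<Longrightarrow> (p has_derivative (\<lambda>v. G z \<bullet> v)) (at z)"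
    and G: "continuous_on U G" and level: "\<And>z. z \<in> c \<Longrightarrow> p z = P0"
    and regular: "\<And>z. z \<in> c \<Longrightarrow> G z \<noteq> 0"
    and \<gamma>: "pos_oriented_param c \<gamma>" and \<delta>: "pos_oriented_param c \<delta>"
    and f: "continuous_on c f"
  shows "\<exists>I. (f has_contour_integral I) \<delta> \<and> (f has_contour_integral I) \<gamma>"
proof -
  have \<gamma>': "valid_path \<gamma>" "simple_path \<gamma>" "pathfinish \<gamma> = pathstart \<gamma>" "path_image \<gamma> = c"
   and \<delta>': "valid_path \<delta>" "simple_path \<delta>" "pathfinish \<delta> = pathstart \<delta>" "path_image \<delta> = c"
    using \<gamma> \<delta> by (auto simp: pos_oriented_param_def)
  obtain w where w: "w \<notin> c" "winding_number \<gamma> w = 1"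
    using \<gamma> by (auto simp: pos_oriented_param_def)
  obtain w' where w': "w' \<notin> c" "winding_number \<delta> w' = 1"
    using \<delta> by (auto simp: pos_oriented_param_def)
  have inside: "w \<in> inside c" "w' \<in> inside c"
    using w w' winding_number_zero_in_outside[of \<gamma> w] winding_number_zero_in_outside[of \<delta> w'] \<gamma>' \<delta>'
    by (auto simp: inside_outside simple_path_imp_path)
  then have "winding_number \<delta> w = 1"
  proof -
    have "winding_number \<delta> w' \<noteq> - 1" using w' by simp
    then show ?thesis
      using simple_closed_path_winding_number_inside[OF \<delta>'(2)] inside \<delta>'(4) by metis
  qed
  obtain a where a: "a \<in> {0..1}" "\<gamma> a = pathstart \<delta>"
    using \<gamma>'(4) \<delta>'(4) by (metis (no_types, lifting) imageE path_image_def pathstart_in_path_image)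
  define \<beta> where "\<beta> = shiftpath a \<gamma>"
  have \<beta>: "valid_path \<beta>" "simple_path \<beta>" "pathfinish \<beta> = pathstart \<beta>" "path_image \<beta> = c" "pathstart \<beta> = pathstart \<delta>"
    using a \<gamma>' unfolding \<beta>_def
    by (auto intro: valid_path_shiftpath simple_path_shiftpath simp: closed_shiftpath path_image_shiftpath pathstart_shiftpath)
  have wn\<beta>: "winding_number \<beta> w = 1"
    unfolding \<beta>_def using winding_number_shiftpath[of \<gamma> w a] a \<gamma>' w by (simp add: simple_path_imp_path)
  obtain k where k: "continuous_on {0..1} k" "strict_mono_on {0..1} k" "k 0 = 0" "k 1 = (1::real)"
    "(\<forall>t\<in>{0..1}. \<delta> t = \<beta> (k t)) \<or> (\<forall>t\<in>{0..1}. reversepath \<delta> t = \<beta> (k t))"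
    by (rule loop_reparametrization[OF \<beta>(2,3) \<delta>'(2,3)]) (use \<beta> \<delta>' in auto)
  have k01: "k t \<in> {0..1}" if "t \<in> {0..1}" for t
    using strict_mono_on_leD[OF k(2), of 0 t] strict_mono_on_leD[OF k(2), of t 1] that k(3,4) by auto
  have same: "\<forall>t\<in>{0..1}. \<delta> t = \<beta> (k t)"
  proof (rule ccontr)
    assume "\<not> ?thesis"
    then have "homotopic_paths (-{w}) \<beta> (reversepath \<delta>)"
      using k k01 \<beta> w(1) by (intro homotopic_paths_reparametrize[of \<beta> _ k]) (auto simp: simple_path_imp_path)
    then have "winding_number \<beta> w = - winding_number \<delta> w"
      using winding_number_homotopic_paths winding_number_reversepath[of \<delta> w] \<delta>' w(1) by (simp add: simple_path_imp_path)
    then show False using wn\<beta> \<open>winding_number \<delta> w = 1\<close> by simp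
  qed
  obtain I where "(f has_contour_integral I) \<delta>" "(f has_contour_integral I) \<beta>"
    using has_contour_integral_reparametrized_level_curve[OF U p G level regular \<beta>(1) _ \<delta>'(1,2) _ k(1-4) _ f]
      same \<beta>(4) \<delta>'(4) by blast
  then show ?thesis
    using has_contour_integral_shiftpath_D[of f I a \<gamma>] \<gamma>' a unfolding \<beta>_def by blast
qed

section \<open>Continuously differentiable maps\<close>

definition C1_on :: "'a::real_normed_vector set \<Rightarrow> ('a \<Rightarrow> 'b::real_normed_vector) \<Rightarrow> bool" where
  "C1_on S f \<longleftrightarrow> Ck_on (Suc 0) S f"

lemma C1_on_iff:
  "C1_on S f \<longleftrightarrow> (\<exists>f'. (\<forall>x\<in>S. (f has_derivative f' x) (at x)) \<and> (\<forall>v. continuous_on S (\<lambda>x. f' x v)))"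
proof
  assume "C1_on S f"
  then show "\<exists>f'. (\<forall>x\<in>S. (f has_derivative f' x) (at x)) \<and> (\<forall>v. continuous_on S (\<lambda>x. f' x v))"
    by (intro exI[of _ "\<lambda>x. frechet_derivative f (at x)"]) (simp add: C1_on_def frechet_derivative_works)
next
  assume "\<exists>f'. (\<forall>x\<in>S. (f has_derivative f' x) (at x)) \<and> (\<forall>v. continuous_on S (\<lambda>x. f' x v))"
  then obtain f' where f': "\<And>x. x \<in> S \<Longrightarrow> (f has_derivative f' x) (at x)" "\<And>v. continuous_on S (\<lambda>x. f' x v)"
    by blast
  have "continuous_on S (\<lambda>x. frechet_derivative f (at x) v)" for v
  proof -
    have "frechet_derivative f (at x) v = f' x v" if "x \<in> S" for x
      using frechet_derivative_at[OF f'(1)[OF that]] by simp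
    then show ?thesis using f'(2)[of v] by (subst continuous_on_cong[OF refl]) auto
  qed
  then show "C1_on S f" using f'(1) by (auto simp: C1_on_def differentiable_def)
qed

lemma C1_onD:
  assumes "C1_on S f"
  shows "x \<in> S \<Longrightarrow> (f has_derivative frechet_derivative f (at x)) (at x)"
    and "continuous_on S (\<lambda>x. frechet_derivative f (at x) v)"
    and "continuous_on S f"
proof -
  show d: "x \<in> S \<Longrightarrow> (f has_derivative frechet_derivative f (at x)) (at x)" for x
    using assms by (simp add: C1_on_def frechet_derivative_works)
  show "continuous_on S (\<lambda>x. frechet_derivative f (at x) v)"
    using assms by (simp add: C1_on_def)
  show "continuous_on S f"
    using d has_derivative_continuous continuous_at_imp_continuous_on by blast
qed

lemma Ck_on_subset: "Ck_on k S f \<Longrightarrow> T \<subseteq> S \<Longrightarrow> Ck_on k T f"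
  by (induction k arbitrary: f) (auto intro: continuous_on_subset)

named_theorems C1_intros

lemma C1_on_const [C1_intros]: "C1_on S (\<lambda>x. c)"
  unfolding C1_on_iff by (intro exI[of _ "\<lambda>_ _. 0"]) auto

lemma C1_on_bounded_linear:
  assumes "bounded_linear g" "C1_on S f"
  shows "C1_on S (\<lambda>x. g (f x))"
proof -
  obtain f' where f': "\<And>x. x \<in> S \<Longrightarrow> (f has_derivative f' x) (at x)" "\<And>v. continuous_on S (\<lambda>x. f' x v)"
    using assms(2) unfolding C1_on_iff by blast
  show ?thesis
    unfolding C1_on_iff
    by (intro exI[of _ "\<lambda>x v. g (f' x v)"])
      (auto intro!: bounded_linear.has_derivative[OF assms(1)] f' bounded_linear.continuous_on[OF assms(1)])
qed

lemmas C1_on_simple_linear [C1_intros] =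
  C1_on_bounded_linear[OF bounded_linear_Re] C1_on_bounded_linear[OF bounded_linear_Im]
  C1_on_bounded_linear[OF bounded_linear_vec_nth] C1_on_bounded_linear[OF bounded_linear_minus[OF bounded_linear_ident]]

lemma C1_on_add [C1_intros]:
  assumes "C1_on S f" "C1_on S g"
  shows "C1_on S (\<lambda>x. f x + g x)"
proof -
  obtain f' where f': "\<And>x. x \<in> S \<Longrightarrow> (f has_derivative f' x) (at x)" "\<And>v. continuous_on S (\<lambda>x. f' x v)"
    using assms(1) unfolding C1_on_iff by blast
  obtain g' where g': "\<And>x. x \<in> S \<Longrightarrow> (g has_derivative g' x) (at x)" "\<And>v. continuous_on S (\<lambda>x. g' x v)"
    using assms(2) unfolding C1_on_iff by blast
  show ?thesis
    unfolding C1_on_iff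
    by (intro exI[of _ "\<lambda>x v. f' x v + g' x v"]) (auto intro!: has_derivative_add f' g' continuous_intros)
qed

lemma C1_on_diff [C1_intros]:
  assumes "C1_on S f" "C1_on S g"
  shows "C1_on S (\<lambda>x. f x - g x)"
  using C1_on_add[OF assms(1) C1_on_simple_linear(4)[OF assms(2)]] by simp

lemma (in bounded_bilinear) C1_on_bilinear:
  assumes "C1_on S f" "C1_on S g"
  shows "C1_on S (\<lambda>x. prod (f x) (g x))"
proof -
  obtain f' where f': "\<And>x. x \<in> S \<Longrightarrow> (f has_derivative f' x) (at x)" "\<And>v. continuous_on S (\<lambda>x. f' x v)"
    using assms(1) unfolding C1_on_iff by blast
  obtain g' where g': "\<And>x. x \<in> S \<Longrightarrow> (g has_derivative g' x) (at x)" "\<And>v. continuous_on S (\<lambda>x. g' x v)"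
    using assms(2) unfolding C1_on_iff by blast
  show ?thesis
    unfolding C1_on_iff
    by (intro exI[of _ "\<lambda>x v. prod (f x) (g' x v) + prod (f' x v) (g x)"])
      (auto intro!: FDERIV f' g' continuous_on_add continuous_on C1_onD(3)[OF assms(1)] C1_onD(3)[OF assms(2)])
qed

lemmas C1_on_mult [C1_intros] = bounded_bilinear.C1_on_bilinear[OF bounded_bilinear_mult]
  and C1_on_inner [C1_intros] = bounded_bilinear.C1_on_bilinear[OF bounded_bilinear_inner]
  and C1_on_scaleR [C1_intros] = bounded_bilinear.C1_on_bilinear[OF bounded_bilinear_scaleR]

lemma C1_on_power2 [C1_intros]:
  fixes f :: "'a::real_normed_vector \<Rightarrow> real"
  shows "C1_on S f \<Longrightarrow> C1_on S (\<lambda>x. (f x)\<^sup>2)"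
  unfolding power2_eq_square by (intro C1_intros)

lemma C1_on_divide [C1_intros]:
  fixes f g :: "'a::real_normed_vector \<Rightarrow> real"
  assumes "C1_on S f" "C1_on S g" "\<And>x. x \<in> S \<Longrightarrow> g x \<noteq> 0"
  shows "C1_on S (\<lambda>x. f x / g x)"
proof -
  obtain g' where g': "\<And>x. x \<in> S \<Longrightarrow> (g has_derivative g' x) (at x)" "\<And>v. continuous_on S (\<lambda>x. g' x v)"
    using assms(2) unfolding C1_on_iff by blast
  have "C1_on S (\<lambda>x. inverse (g x))"
    unfolding C1_on_iff
    by (intro exI[of _ "\<lambda>x v. - (inverse (g x) * g' x v * inverse (g x))"])
      (auto intro!: Deriv.has_derivative_inverse g' assms continuous_intros C1_onD(3)[OF assms(2)])
  from C1_on_mult[OF assms(1) this] show ?thesis by (simp add: divide_inverse)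
qed

lemma C1_on_Complex [C1_intros]:
  assumes "C1_on S f" "C1_on S g"
  shows "C1_on S (\<lambda>x. Complex (f x) (g x))"
proof -
  have "C1_on S (\<lambda>x. f x *\<^sub>R 1 + g x *\<^sub>R \<i>)"
    by (intro C1_intros assms)
  moreover have "(\<lambda>x. f x *\<^sub>R 1 + g x *\<^sub>R \<i>) = (\<lambda>x. Complex (f x) (g x))"
    by (auto simp: complex_eq_iff)
  ultimately show ?thesis by simp
qed

lemma smooth_on_imp_C1_on:
  assumes "smooth_on U f"
  shows "C1_on U f" "C1_on U (\<lambda>x. frechet_derivative f (at x) v)"
proof -
  have "Ck_on (Suc 0) U f" "Ck_on (Suc (Suc 0)) U f" using assms unfolding smooth_on_def by blast+
  then show "C1_on U f" "C1_on U (\<lambda>x. frechet_derivative f (at x) v)" by (simp_all add: C1_on_def)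
qed

lemma smooth_on_subset: "smooth_on U f \<Longrightarrow> open V \<Longrightarrow> V \<subseteq> U \<Longrightarrow> smooth_on V f"
  by (auto simp: smooth_on_def intro: Ck_on_subset)

lemma frechet_derivative_commute:
  fixes f :: "'a::real_normed_vector \<Rightarrow> 'b::banach"
  assumes f: "smooth_on U f" and x: "x \<in> U"
  shows "frechet_derivative (\<lambda>y. frechet_derivative f (at y) v) (at x) w
       = frechet_derivative (\<lambda>y. frechet_derivative f (at y) w) (at x) v"
proof -
  have "open U" using f by (simp add: smooth_on_def)
  then obtain e where e: "e > 0" "ball x e \<subseteq> U" using x open_contains_ball by blast
  define \<epsilon> where "\<epsilon> = e / (norm v + norm w + 1)"
  have pos: "norm v + norm w + 1 > 0" by (smt (verit) norm_ge_zero)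
  then have \<epsilon>: "\<epsilon> > 0" using e by (simp add: \<epsilon>_def)
  have inU: "x + r *\<^sub>R v + t *\<^sub>R w \<in> U" if "r \<in> {0..\<epsilon>}" "t \<in> {0..\<epsilon>}" for r t
  proof -
    have "norm (r *\<^sub>R v + t *\<^sub>R w) \<le> r * norm v + t * norm w"
      using that norm_triangle_ineq[of "r *\<^sub>R v" "t *\<^sub>R w"] by simp
    also have "\<dots> \<le> \<epsilon> * norm v + \<epsilon> * norm w"
      using that by (intro add_mono mult_right_mono) auto
    also have "\<dots> < \<epsilon> * (norm v + norm w + 1)" using \<epsilon> by (simp add: algebra_simps)
    also have "\<dots> = e" using pos by (simp add: \<epsilon>_def)
    finally show ?thesis using e(2) by (auto simp: dist_norm add.assoc norm_minus_commute subset_iff)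
  qed
  let ?g = "\<lambda>v y. frechet_derivative f (at y) v"
  define h where "h = (\<lambda>y. frechet_derivative (?g v) (at y) w)"
  have h: "continuous_on U h"
    unfolding h_def by (intro C1_onD(2) smooth_on_imp_C1_on(2)[OF f])
  have along: "((\<lambda>s. F (y + s *\<^sub>R d)) has_vector_derivative frechet_derivative F (at (y + s *\<^sub>R d)) d) (at s within T)"
    if "C1_on U F" "y + s *\<^sub>R d \<in> U" for F :: "'a \<Rightarrow> 'b" and y d s T
  proof -
    have D: "(F has_derivative frechet_derivative F (at (y + s *\<^sub>R d))) (at (y + s *\<^sub>R d))"
      by (rule C1_onD(1)[OF that])
    have "((\<lambda>s. F (y + s *\<^sub>R d)) has_derivative (\<lambda>r. frechet_derivative F (at (y + s *\<^sub>R d)) (r *\<^sub>R d))) (at s within T)"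
      by (rule has_derivative_compose[where f="\<lambda>s. y + s *\<^sub>R d" and g=F]) (use D in \<open>auto intro!: derivative_eq_intros\<close>)
    then show ?thesis
      unfolding has_vector_derivative_def
      using linear_cmul[OF has_derivative_linear[OF D]] by simp
  qed
  have mixed: "?g w (x + s *\<^sub>R v) - ?g w x = integral {0..s} (\<lambda>r. h (x + r *\<^sub>R v))" if s: "s \<in> {0..\<epsilon>}" for s
  proof -
    have leib: "((\<lambda>t. integral (cbox 0 s) (\<lambda>r. ?g v (x + r *\<^sub>R v + t *\<^sub>R w))) has_vector_derivative
        integral (cbox 0 s) (\<lambda>r. h (x + r *\<^sub>R v + 0 *\<^sub>R w))) (at 0 within {0..\<epsilon>})"
    proof (rule leibniz_rule_vector_derivative)
      show "((\<lambda>t. ?g v (x + r *\<^sub>R v + t *\<^sub>R w)) has_vector_derivative h (x + r *\<^sub>R v + t *\<^sub>R w)) (at t within {0..\<epsilon>})"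
        if "t \<in> {0..\<epsilon>}" "r \<in> cbox 0 s" for t r
        unfolding h_def by (rule along) (use that s inU in \<open>auto intro: smooth_on_imp_C1_on(2)[OF f]\<close>)
      show "(\<lambda>r. ?g v (x + r *\<^sub>R v + t *\<^sub>R w)) integrable_on cbox 0 s" if "t \<in> {0..\<epsilon>}" for t
        by (rule integrable_continuous, rule continuous_on_compose2[OF C1_onD(2)[OF smooth_on_imp_C1_on(1)[OF f]]])
          (use that s inU in \<open>auto intro!: continuous_intros\<close>)
      show "continuous_on ({0..\<epsilon>} \<times> cbox 0 s) (\<lambda>(t, r). h (x + r *\<^sub>R v + t *\<^sub>R w))"
        unfolding case_prod_unfold
        by (rule continuous_on_compose2[OF h]) (use s inU in \<open>auto intro!: continuous_intros\<close>)
    qed (use \<epsilon> in auto)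
    have val: "integral (cbox 0 s) (\<lambda>r. ?g v (x + r *\<^sub>R v + t *\<^sub>R w)) = f (x + s *\<^sub>R v + t *\<^sub>R w) - f (x + t *\<^sub>R w)"
      if t: "t \<in> {0..\<epsilon>}" for t
    proof -
      have "((\<lambda>r. ?g v (x + t *\<^sub>R w + r *\<^sub>R v)) has_integral f (x + t *\<^sub>R w + s *\<^sub>R v) - f (x + t *\<^sub>R w + 0 *\<^sub>R v)) {0..s}"
      proof (rule fundamental_theorem_of_calculus)
        fix r assume "r \<in> {0..s}"
        then have "x + t *\<^sub>R w + r *\<^sub>R v \<in> U" using inU[of r t] s t by (simp add: add_ac)
        then show "((\<lambda>r. f (x + t *\<^sub>R w + r *\<^sub>R v)) has_vector_derivative ?g v (x + t *\<^sub>R w + r *\<^sub>R v)) (at r within {0..s})"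
          by (rule along[OF smooth_on_imp_C1_on(1)[OF f]])
      qed (use s in auto)
      then show ?thesis by (simp add: integral_unique add_ac)
    qed
    have "((\<lambda>t. f (x + s *\<^sub>R v + t *\<^sub>R w) - f (x + t *\<^sub>R w)) has_vector_derivative
        integral (cbox 0 s) (\<lambda>r. h (x + r *\<^sub>R v + 0 *\<^sub>R w))) (at 0 within {0..\<epsilon>})"
      by (rule has_vector_derivative_transform[OF _ val[symmetric] leib]) (use \<epsilon> in auto)
    moreover have "((\<lambda>t. f (x + s *\<^sub>R v + t *\<^sub>R w) - f (x + t *\<^sub>R w)) has_vector_derivative
        ?g w (x + s *\<^sub>R v + 0 *\<^sub>R w) - ?g w (x + 0 *\<^sub>R w)) (at 0 within {0..\<epsilon>})"
      using inU[of s 0] s \<epsilon> x by (intro has_vector_derivative_diff along smooth_on_imp_C1_on(1)[OF f]) auto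
    ultimately have "?g w (x + s *\<^sub>R v + 0 *\<^sub>R w) - ?g w (x + 0 *\<^sub>R w) = integral (cbox 0 s) (\<lambda>r. h (x + r *\<^sub>R v + 0 *\<^sub>R w))"
      by (intro vector_derivative_unique_within_closed_interval[of 0 \<epsilon> 0]) (use \<epsilon> in auto)
    then show ?thesis by simp
  qed
  have prim: "((\<lambda>s. integral {0..s} (\<lambda>r. h (x + r *\<^sub>R v))) has_vector_derivative h (x + 0 *\<^sub>R v)) (at 0 within {0..\<epsilon>})"
    by (rule integral_has_vector_derivative, rule continuous_on_compose2[OF h])
      (use \<epsilon> inU[of _ 0] in \<open>auto intro!: continuous_intros\<close>)
  have "((\<lambda>s. ?g w (x + s *\<^sub>R v) - ?g w x) has_vector_derivative h (x + 0 *\<^sub>R v)) (at 0 within {0..\<epsilon>})"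
    by (rule has_vector_derivative_transform[OF _ mixed prim]) (use \<epsilon> in auto)
  moreover have "((\<lambda>s. ?g w (x + s *\<^sub>R v) - ?g w x) has_vector_derivative
      frechet_derivative (?g w) (at (x + 0 *\<^sub>R v)) v - 0) (at 0 within {0..\<epsilon>})"
    using x by (intro has_vector_derivative_diff along smooth_on_imp_C1_on(2)[OF f]) auto
  ultimately have "h (x + 0 *\<^sub>R v) = frechet_derivative (?g w) (at (x + 0 *\<^sub>R v)) v - 0"
    by (intro vector_derivative_unique_within_closed_interval[of 0 \<epsilon> 0]) (use \<epsilon> in auto)
  then show ?thesis by (simp add: h_def)
qed

section \<open>Fields of the spatial dynamics\<close>

definition Dpsi_inv :: "(real \<Rightarrow> complex \<Rightarrow> complex) \<Rightarrow> real \<Rightarrow> complex \<Rightarrow> complex \<Rightarrow> complex" where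
  "Dpsi_inv \<psi> \<zeta> z b =
     Complex (cdet b (psid \<psi> \<zeta> z e_y) / rho_dens \<psi> \<zeta> z) (cdet (psid \<psi> \<zeta> z e_x) b / rho_dens \<psi> \<zeta> z)"

lemma gram_nonzero:
  assumes "vol_dens X \<zeta> z \<noteq> 0"
  shows "h_xx X \<zeta> z * h_yy X \<zeta> z - (h_xy X \<zeta> z)\<^sup>2 \<noteq> 0"
proof
  define c a b where "c = Xd X \<zeta> z e_zeta" and "a = Xd X \<zeta> z e_x" and "b = Xd X \<zeta> z e_y"
  define p q r where "p = vec_nth a 2 * vec_nth b 3 - vec_nth a 3 * vec_nth b 2"
    and "q = vec_nth a 1 * vec_nth b 3 - vec_nth a 3 * vec_nth b 1" and "r = vec_nth a 1 * vec_nth b 2 - vec_nth a 2 * vec_nth b 1"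
  assume "h_xx X \<zeta> z * h_yy X \<zeta> z - (h_xy X \<zeta> z)\<^sup>2 = 0"
  then have "p\<^sup>2 + q\<^sup>2 + r\<^sup>2 = 0"
    unfolding h_xx_def h_yy_def h_xy_def a_def[symmetric] b_def[symmetric] inner_vec_def sum_3 inner_real_def p_def q_def r_def
    by algebra
  then have "p = 0" "q = 0" "r = 0" by (smt (verit) zero_le_power2 power2_eq_iff zero_eq_power2)+
  moreover have "vol_dens X \<zeta> z = vec_nth c 1 * p - vec_nth c 2 * q + vec_nth c 3 * r"
    unfolding vol_dens_def det3_def p_def q_def r_def a_def b_def c_def ..
  ultimately show False using assms by simp
qed

lemma C1_on_Xd: "smooth_on U X \<Longrightarrow> C1_on U (\<lambda>x. Xd X (fst x) (snd x) v)"
  unfolding Xd_def prod.collapse by (rule smooth_on_imp_C1_on(2))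

lemma C1_on_psid: "smooth_on U (\<lambda>(s, w). \<psi> s w) \<Longrightarrow> C1_on U (\<lambda>x. psid \<psi> (fst x) (snd x) v)"
  unfolding psid_def prod.collapse by (rule smooth_on_imp_C1_on(2))

lemma C1_on_vol_dens: "smooth_on U X \<Longrightarrow> C1_on U (\<lambda>x. vol_dens X (fst x) (snd x))"
  unfolding vol_dens_def det3_def by (intro C1_intros C1_on_Xd)

lemma C1_on_rho_dens: "smooth_on U (\<lambda>(s, w). \<psi> s w) \<Longrightarrow> C1_on U (\<lambda>x. rho_dens \<psi> (fst x) (snd x))"
  unfolding rho_dens_def cdet_def by (intro C1_intros C1_on_psid)

lemma linear_coordinates:
  assumes "linear L"
  shows "L (\<alpha>, w) = \<alpha> *\<^sub>R L e_zeta + Re w *\<^sub>R L e_x + Im w *\<^sub>R L e_y"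
proof -
  have "(\<alpha>, w) = \<alpha> *\<^sub>R e_zeta + Re w *\<^sub>R e_x + Im w *\<^sub>R e_y"
    by (auto simp: e_zeta_def e_x_def e_y_def complex_eq_iff)
  then show ?thesis using assms by (simp add: linear_add linear_scale)
qed

lemma cramer_complex:
  assumes "cdet a b \<noteq> 0"
  shows "Complex (cdet (x *\<^sub>R a + y *\<^sub>R b) b / cdet a b) (cdet a (x *\<^sub>R a + y *\<^sub>R b) / cdet a b) = Complex x y"
proof -
  have "cdet (x *\<^sub>R a + y *\<^sub>R b) b = x * cdet a b" "cdet a (x *\<^sub>R a + y *\<^sub>R b) = y * cdet a b"
    by (simp_all add: cdet_def algebra_simps)
  then show ?thesis using assms by simp
qed

lemma cramer_complex_solves:
  assumes "cdet a b \<noteq> 0"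
  shows "(cdet c b / cdet a b) *\<^sub>R a + (cdet a c / cdet a b) *\<^sub>R b = c"
proof -
  have "cdet c b *\<^sub>R a + cdet a c *\<^sub>R b = cdet a b *\<^sub>R c"
    by (simp add: cdet_def complex_eq_iff algebra_simps)
  from arg_cong[OF this, of "\<lambda>x. (1 / cdet a b) *\<^sub>R x"] assms show ?thesis
    by (simp add: scaleR_add_right)
qed

locale spatial_path =
  fixes X :: "real \<times> complex \<Rightarrow> real^3" and \<psi> :: "real \<Rightarrow> complex \<Rightarrow> complex" and U :: "(real \<times> complex) set"
  assumes X_smooth: "smooth_on U X"
    and \<psi>_smooth: "smooth_on U (\<lambda>(s, w). \<psi> s w)"
    and vol_nonzero: "\<And>x. x \<in> U \<Longrightarrow> vol_dens X (fst x) (snd x) \<noteq> 0"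
    and rho_nonzero: "\<And>x. x \<in> U \<Longrightarrow> rho_dens \<psi> (fst x) (snd x) \<noteq> 0"
begin

lemmas C1_Xd [C1_intros] = C1_on_Xd[OF X_smooth]
  and C1_vol_dens [C1_intros] = C1_on_vol_dens[OF X_smooth]
  and C1_psid [C1_intros] = C1_on_psid[OF \<psi>_smooth]
  and C1_rho_dens [C1_intros] = C1_on_rho_dens[OF \<psi>_smooth]

lemma C1_metric [C1_intros]:
  "C1_on U (\<lambda>x. h_xx X (fst x) (snd x))" "C1_on U (\<lambda>x. h_xy X (fst x) (snd x))"
  "C1_on U (\<lambda>x. h_yy X (fst x) (snd x))"
  unfolding h_xx_def h_xy_def h_yy_def by (intro C1_intros)+

lemma C1_shift [C1_intros]: "C1_on U (\<lambda>x. shift X (fst x) (snd x))"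
  unfolding shift_def Let_def by (intro C1_intros gram_nonzero vol_nonzero)

lemma C1_dens_n [C1_intros]: "C1_on U (\<lambda>x. dens_n X \<psi> (fst x) (snd x))"
  unfolding dens_n_def by (intro C1_intros vol_nonzero)

lemma C1_vel_u [C1_intros]: "C1_on U (\<lambda>x. vel_u \<psi> (fst x) (snd x))"
  unfolding vel_u_def cdet_def by (intro C1_intros rho_nonzero)

lemma C1_Dpsi_inv [C1_intros]: "C1_on U (\<lambda>x. Dpsi_inv \<psi> (fst x) (snd x) b)"
  unfolding Dpsi_inv_def cdet_def by (intro C1_intros rho_nonzero)

lemma C1_momentum: "C1_on U (\<lambda>(s, w). momentum X \<psi> s w)"
  unfolding case_prod_unfold momentum_def flat_def by (intro C1_intros)

lemma C1_energy_term: "C1_on U (\<lambda>(s, w). energy_term X \<psi> s w)"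
  unfolding case_prod_unfold energy_term_def lapse_sq_def hform_def by (intro C1_intros)

lemma C1_vel_u': "C1_on U (\<lambda>(s, w). vel_u \<psi> s w)"
  unfolding case_prod_unfold by (rule C1_vel_u)

lemma psid_eq: "psid \<psi> \<zeta> z (a, w) = a *\<^sub>R psid \<psi> \<zeta> z e_zeta + Re w *\<^sub>R psid \<psi> \<zeta> z e_x + Im w *\<^sub>R psid \<psi> \<zeta> z e_y"
  if "(\<zeta>, z) \<in> U"
proof -
  have "linear (psid \<psi> \<zeta> z)"
    unfolding psid_def using C1_onD(1)[OF smooth_on_imp_C1_on(1)[OF \<psi>_smooth] that] has_derivative_linear by blast
  then show ?thesis by (rule linear_coordinates)
qed

lemma psid_Dpsi_inv: "Re (Dpsi_inv \<psi> \<zeta> z b) *\<^sub>R psid \<psi> \<zeta> z e_x + Im (Dpsi_inv \<psi> \<zeta> z b) *\<^sub>R psid \<psi> \<zeta> z e_y = b"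
  if "(\<zeta>, z) \<in> U"
  using cramer_complex_solves[of "psid \<psi> \<zeta> z e_x" "psid \<psi> \<zeta> z e_y" b] rho_nonzero[OF that]
  by (simp add: Dpsi_inv_def rho_dens_def)

lemma Dpsi_inv_unique: "Dpsi_inv \<psi> \<zeta> z b = w"
  if "(\<zeta>, z) \<in> U" "Re w *\<^sub>R psid \<psi> \<zeta> z e_x + Im w *\<^sub>R psid \<psi> \<zeta> z e_y = b"
  using cramer_complex[of "psid \<psi> \<zeta> z e_x" "psid \<psi> \<zeta> z e_y" "Re w" "Im w"] rho_nonzero[OF that(1)] that(2)
  by (simp add: Dpsi_inv_def rho_dens_def)

lemma linear_Dpsi_inv: "linear (Dpsi_inv \<psi> \<zeta> z)"
  by (rule linearI) (simp_all add: Dpsi_inv_def cdet_def complex_eq_iff add_divide_distrib diff_divide_distrib algebra_simps)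

lemma vel_u_eq: "vel_u \<psi> \<zeta> z = - Dpsi_inv \<psi> \<zeta> z (psid \<psi> \<zeta> z e_zeta)"
  by (simp add: vel_u_def Dpsi_inv_def complex_eq_iff)

lemma psid_vel_u: "psid \<psi> \<zeta> z e_zeta + Re (vel_u \<psi> \<zeta> z) *\<^sub>R psid \<psi> \<zeta> z e_x + Im (vel_u \<psi> \<zeta> z) *\<^sub>R psid \<psi> \<zeta> z e_y = 0"
  if "(\<zeta>, z) \<in> U"
  using psid_Dpsi_inv[OF that, of "psid \<psi> \<zeta> z e_zeta"] unfolding vel_u_eq by (simp add: add_eq_0_iff2 algebra_simps)

lemma C1_\<psi>: "C1_on U (\<lambda>(s, w). \<psi> s w)"
  by (rule smooth_on_imp_C1_on(1)[OF \<psi>_smooth])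

lemma has_derivative_\<psi>: "((\<lambda>x. \<psi> (fst x) (snd x)) has_derivative psid \<psi> \<zeta> z) (at (\<zeta>, z))" if "(\<zeta>, z) \<in> U"
  using C1_onD(1)[OF C1_\<psi> that] unfolding psid_def case_prod_unfold by simp

text \<open>A vector frozen into the reference disc obeys the linearised flow equation of \<^const>\<open>vel_u\<close>.\<close>

lemma Dpsi_inv_along_flow:
  assumes x: "(\<zeta>, z) \<in> U"
  shows "frechet_derivative (\<lambda>x. Dpsi_inv \<psi> (fst x) (snd x) b) (at (\<zeta>, z)) (1, vel_u \<psi> \<zeta> z)
       = frechet_derivative (\<lambda>(s, w). vel_u \<psi> s w) (at (\<zeta>, z)) (0, Dpsi_inv \<psi> \<zeta> z b)"
proof -
  define x where "x = (\<zeta>, z)"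
  define g where "g = (\<lambda>v y. psid \<psi> (fst y) (snd y) v)"
  define W V where "W = (\<lambda>y. Dpsi_inv \<psi> (fst y) (snd y) b)" and "V = (\<lambda>y. vel_u \<psi> (fst y) (snd y))"
  define D where "D = (\<lambda>v. frechet_derivative (g v) (at x))"
  define DW DV where "DW = frechet_derivative W (at x)" and "DV = frechet_derivative V (at x)"
  have xU: "x \<in> U" using assms by (simp add: x_def)
  have openU: "open U" using \<psi>_smooth by (simp add: smooth_on_def)
  have Dg: "(g v has_derivative D v) (at x)" for v
    unfolding D_def g_def by (rule C1_onD(1)[OF C1_psid xU])
  have DW: "(W has_derivative DW) (at x)"
    unfolding DW_def W_def by (rule C1_onD(1)[OF C1_Dpsi_inv xU])
  have DV: "(V has_derivative DV) (at x)"
    unfolding DV_def V_def by (rule C1_onD(1)[OF C1_vel_u xU])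
  have sym: "D v w = D w v" for v w
    using frechet_derivative_commute[OF \<psi>_smooth xU, of v w] unfolding D_def g_def psid_def by simp
  have lin: "D v (\<alpha>, w) = \<alpha> *\<^sub>R D v e_zeta + Re w *\<^sub>R D v e_x + Im w *\<^sub>R D v e_y" for v \<alpha> w
    by (rule linear_coordinates[OF has_derivative_linear[OF Dg]])
  have zero: "F' = (\<lambda>_. 0)" if "(F has_derivative F') (at x)" "\<And>y. y \<in> U \<Longrightarrow> F y = c" for F F' and c :: complex
  proof -
    have "(F has_derivative (\<lambda>_. 0)) (at x)"
      by (rule has_derivative_transform_within_open[of "\<lambda>_. c" _ x UNIV U]) (use that openU xU in auto)
    with that(1) show ?thesis by (rule has_derivative_unique)
  qed
  have 1: "(\<lambda>h. (Re (W x) *\<^sub>R D e_x h + Re (DW h) *\<^sub>R g e_x x) + (Im (W x) *\<^sub>R D e_y h + Im (DW h) *\<^sub>R g e_y x)) = (\<lambda>_. 0)"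
  proof (rule zero)
    show "((\<lambda>y. Re (W y) *\<^sub>R g e_x y + Im (W y) *\<^sub>R g e_y y) has_derivative
       (\<lambda>h. (Re (W x) *\<^sub>R D e_x h + Re (DW h) *\<^sub>R g e_x x) + (Im (W x) *\<^sub>R D e_y h + Im (DW h) *\<^sub>R g e_y x))) (at x)"
      by (intro has_derivative_add has_derivative_scaleR Dg
          bounded_linear.has_derivative[OF bounded_linear_Re] bounded_linear.has_derivative[OF bounded_linear_Im] DW)
    show "Re (W y) *\<^sub>R g e_x y + Im (W y) *\<^sub>R g e_y y = b" if "y \<in> U" for y
      using psid_Dpsi_inv[of "fst y" "snd y" b] that by (simp add: W_def g_def)
  qed
  have 2: "(\<lambda>h. D e_zeta h + (Re (V x) *\<^sub>R D e_x h + Re (DV h) *\<^sub>R g e_x x) + (Im (V x) *\<^sub>R D e_y h + Im (DV h) *\<^sub>R g e_y x)) = (\<lambda>_. 0)"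
  proof (rule zero)
    show "((\<lambda>y. g e_zeta y + Re (V y) *\<^sub>R g e_x y + Im (V y) *\<^sub>R g e_y y) has_derivative
       (\<lambda>h. D e_zeta h + (Re (V x) *\<^sub>R D e_x h + Re (DV h) *\<^sub>R g e_x x) + (Im (V x) *\<^sub>R D e_y h + Im (DV h) *\<^sub>R g e_y x))) (at x)"
      by (intro has_derivative_add has_derivative_scaleR Dg
          bounded_linear.has_derivative[OF bounded_linear_Re] bounded_linear.has_derivative[OF bounded_linear_Im] DV)
    show "g e_zeta y + Re (V y) *\<^sub>R g e_x y + Im (V y) *\<^sub>R g e_y y = 0" if "y \<in> U" for y
      using psid_vel_u[of "fst y" "snd y"] that by (simp add: V_def g_def)
  qed
  define p q where "p = DW (1, V x)" and "q = DV (0, W x)"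
  have e1: "Re (W x) *\<^sub>R D e_x (1, V x) + Re p *\<^sub>R g e_x x + (Im (W x) *\<^sub>R D e_y (1, V x) + Im p *\<^sub>R g e_y x) = 0"
    using fun_cong[OF 1, of "(1, V x)"] by (simp add: p_def)
  have e2: "D e_zeta (0, W x) + (Re (V x) *\<^sub>R D e_x (0, W x) + Re q *\<^sub>R g e_x x) + (Im (V x) *\<^sub>R D e_y (0, W x) + Im q *\<^sub>R g e_y x) = 0"
    using fun_cong[OF 2, of "(0, W x)"] by (simp add: q_def)
  define A where "A = Re (W x) *\<^sub>R D e_x (1, V x) + Im (W x) *\<^sub>R D e_y (1, V x)"
  have A: "D e_zeta (0, W x) + Re (V x) *\<^sub>R D e_x (0, W x) + Im (V x) *\<^sub>R D e_y (0, W x) = A"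
    unfolding A_def
    unfolding lin sym[of e_x e_zeta] sym[of e_y e_zeta] sym[of e_y e_x] by (simp add: algebra_simps)
  have "A + (Re p *\<^sub>R g e_x x + Im p *\<^sub>R g e_y x) = 0"
    using e1 unfolding A_def by (simp only: add_ac)
  moreover have "A + (Re q *\<^sub>R g e_x x + Im q *\<^sub>R g e_y x) = 0"
    using e2 unfolding A[symmetric] by (simp only: add_ac)
  ultimately have "A + (Re p *\<^sub>R g e_x x + Im p *\<^sub>R g e_y x) = A + (Re q *\<^sub>R g e_x x + Im q *\<^sub>R g e_y x)"
    by simp
  then have "Re (p - q) *\<^sub>R g e_x x + Im (p - q) *\<^sub>R g e_y x = 0"
    by (simp add: scaleR_diff_left add_diff_add[symmetric])
  from Dpsi_inv_unique[OF assms this[unfolded g_def x_def fst_conv snd_conv]]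
  have "p - q = Dpsi_inv \<psi> \<zeta> z 0" by simp
  then have "p = q" by (simp add: linear_0[OF linear_Dpsi_inv])
  then show ?thesis
    unfolding p_def q_def DW_def DV_def W_def V_def x_def case_prod_unfold by simp
qed

lemma EL_along_flow:
  assumes x: "(\<zeta>, z) \<in> U" and EL: "EL_eq X ph \<psi> \<zeta> z"
    and p: "(\<lambda>(s, w). pres ph \<psi> s w) differentiable (at (\<zeta>, z))"
    and tangent: "frechet_derivative (\<lambda>(s, w). pres ph \<psi> s w) (at (\<zeta>, z)) (0, w) = 0"
  shows "frechet_derivative (\<lambda>(s, w). momentum X \<psi> s w) (at (\<zeta>, z)) (1, vel_u \<psi> \<zeta> z) \<bullet> w
       + momentum X \<psi> \<zeta> z \<bullet> frechet_derivative (\<lambda>(s, w). vel_u \<psi> s w) (at (\<zeta>, z)) (0, w)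
       = frechet_derivative (\<lambda>(s, w). energy_term X \<psi> s w) (at (\<zeta>, z)) (0, w)"
proof -
  define M V E P where "M = frechet_derivative (\<lambda>(s, w). momentum X \<psi> s w) (at (\<zeta>, z))"
    and "V = frechet_derivative (\<lambda>(s, w). vel_u \<psi> s w) (at (\<zeta>, z))"
    and "E = frechet_derivative (\<lambda>(s, w). energy_term X \<psi> s w) (at (\<zeta>, z))"
    and "P = frechet_derivative (\<lambda>(s, w). pres ph \<psi> s w) (at (\<zeta>, z))"
  define u m n where "u = vel_u \<psi> \<zeta> z" and "m = momentum X \<psi> \<zeta> z" and "n = dens_n X \<psi> \<zeta> z"
  have lin: "linear M" "linear V" "linear E" "linear P"
    unfolding M_def V_def E_def P_def
    using C1_onD(1)[OF C1_momentum x] C1_onD(1)[OF C1_vel_u' x] C1_onD(1)[OF C1_energy_term x] p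
    by (auto simp: frechet_derivative_works intro: has_derivative_linear)
  have M: "M e_zeta + M (0, u) = M (1, u)"
    using linear_add[OF lin(1), of e_zeta "(0, u)"] by (simp add: e_zeta_def)
  have coord: "L (0, w) = Re w *\<^sub>R L (0, 1) + Im w *\<^sub>R L (0, \<i>)" if "linear L" for L :: "real \<times> complex \<Rightarrow> 'c::real_vector"
    using linear_coordinates[OF that, of 0 w] by (simp add: e_x_def e_y_def)
  have "M (1, u) \<bullet> e + m \<bullet> V (0, e) = P (0, e) / n + E (0, e)" if "e \<in> {1, \<i>}" for e
    using EL that unfolding EL_eq_def M_def[symmetric] V_def[symmetric] E_def[symmetric] P_def[symmetric]
      u_def[symmetric] m_def[symmetric] n_def[symmetric] M by blast
  from this[of 1] this[of \<i>]
  have eqs: "M (1, u) \<bullet> 1 + m \<bullet> V (0, 1) = P (0, 1) / n + E (0, 1)" "M (1, u) \<bullet> \<i> + m \<bullet> V (0, \<i>) = P (0, \<i>) / n + E (0, \<i>)"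
    by simp_all
  have "M (1, u) \<bullet> w = Re w * (M (1, u) \<bullet> 1) + Im w * (M (1, u) \<bullet> \<i>)"
    by (simp add: inner_complex_def algebra_simps)
  moreover have "m \<bullet> V (0, w) = Re w * (m \<bullet> V (0, 1)) + Im w * (m \<bullet> V (0, \<i>))"
    by (simp add: coord[OF lin(2)] inner_add_right)
  ultimately have "M (1, u) \<bullet> w + m \<bullet> V (0, w)
      = Re w * (M (1, u) \<bullet> 1 + m \<bullet> V (0, 1)) + Im w * (M (1, u) \<bullet> \<i> + m \<bullet> V (0, \<i>))"
    by (simp add: algebra_simps)
  also have "\<dots> = P (0, w) / n + E (0, w)"
    unfolding eqs coord[OF lin(3)] coord[OF lin(4)] by (simp add: algebra_simps add_divide_distrib)
  finally show ?thesis using tangent by (simp add: M_def V_def E_def P_def u_def m_def)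
qed

lemma Dpsi_inv_coordinates: "Dpsi_inv \<psi> \<zeta> z v = Re v *\<^sub>R Dpsi_inv \<psi> \<zeta> z 1 + Im v *\<^sub>R Dpsi_inv \<psi> \<zeta> z \<i>"
proof -
  have "v = Re v *\<^sub>R 1 + Im v *\<^sub>R \<i>" by (simp add: complex_eq_iff)
  then show ?thesis by (metis linear_add[OF linear_Dpsi_inv] linear_scale[OF linear_Dpsi_inv])
qed

lemma isobar_circulation_unique:
  assumes ph: "smooth_on V ph" and sub: "{\<zeta>} \<times> unit_disc \<subseteq> U" and V: "\<psi> \<zeta> ` unit_disc \<subseteq> V"
    and regular: "\<And>z. z \<in> isobar ph \<psi> \<zeta> P0 \<Longrightarrow> frechet_derivative ph (at (\<psi> \<zeta> z)) \<noteq> (\<lambda>_. 0)"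
    and \<gamma>: "pos_oriented_param (isobar ph \<psi> \<zeta> P0) \<gamma>" and \<delta>: "pos_oriented_param (isobar ph \<psi> \<zeta> P0) \<delta>"
  shows "\<exists>I. ((\<lambda>t. momentum X \<psi> \<zeta> (\<gamma> t) \<bullet> vector_derivative \<gamma> (at t)) has_integral I) {0..1} \<and>
             ((\<lambda>t. momentum X \<psi> \<zeta> (\<delta> t) \<bullet> vector_derivative \<delta> (at t)) has_integral I) {0..1}"
proof -
  have openU: "open U" "open V" using \<psi>_smooth ph by (auto simp: smooth_on_def)
  define U1 where "U1 = Pair \<zeta> -` U"
  define U2 where "U2 = U1 \<inter> \<psi> \<zeta> -` V"
  have "open U1"
    unfolding U1_def by (rule open_vimage) (auto intro!: continuous_intros openU)
  have slice: "continuous_on U1 (\<lambda>z. F (\<zeta>, z))" if "continuous_on U F" for F :: "real \<times> complex \<Rightarrow> 'c::real_normed_vector"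
    by (rule continuous_on_compose2[OF that]) (auto intro!: continuous_intros simp: U1_def)
  have cont\<psi>: "continuous_on U1 (\<psi> \<zeta>)"
    using slice[OF C1_onD(3)[OF C1_\<psi>]] by simp
  have "open U2"
    unfolding U2_def by (rule continuous_open_preimage[OF cont\<psi> \<open>open U1\<close> openU(2)])
  define g where "g = (\<lambda>q. Complex (frechet_derivative ph (at q) 1) (frechet_derivative ph (at q) \<i>))"
  have g: "frechet_derivative ph (at q) v = g q \<bullet> v" if "q \<in> V" for q v
  proof -
    have "linear (frechet_derivative ph (at q))"
      by (rule has_derivative_linear[OF C1_onD(1)[OF smooth_on_imp_C1_on(1)[OF ph] that]])
    then have "frechet_derivative ph (at q) (Re v *\<^sub>R 1 + Im v *\<^sub>R \<i>)
        = Re v * frechet_derivative ph (at q) 1 + Im v * frechet_derivative ph (at q) \<i>"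
      by (simp add: linear_add linear_scale)
    moreover have "Re v *\<^sub>R 1 + Im v *\<^sub>R \<i> = v" by (simp add: complex_eq_iff)
    ultimately show ?thesis by (simp add: g_def inner_complex_def)
  qed
  have contg: "continuous_on V g"
    unfolding g_def Complex_eq
    by (intro continuous_intros C1_onD(2) smooth_on_imp_C1_on(1)[OF ph])
  define G where "G = (\<lambda>z. Complex (g (\<psi> \<zeta> z) \<bullet> psid \<psi> \<zeta> z e_x) (g (\<psi> \<zeta> z) \<bullet> psid \<psi> \<zeta> z e_y))"
  let ?c = "isobar ph \<psi> \<zeta> P0"
  have c_sub: "?c \<subseteq> U2"
    using sub V by (auto simp: isobar_def U1_def U2_def simp del: mem_cball mem_cball_0)
  have "\<exists>I. ((\<lambda>z. cnj (momentum X \<psi> \<zeta> z)) has_contour_integral I) \<delta> \<and> ((\<lambda>z. cnj (momentum X \<psi> \<zeta> z)) has_contour_integral I) \<gamma>"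
  proof (rule contour_integral_level_curve_unique[OF \<open>open U2\<close> c_sub _ _ _ _ \<gamma> \<delta>])
    show "(pres ph \<psi> \<zeta> has_derivative (\<lambda>v. G z \<bullet> v)) (at z)" if z: "z \<in> U2" for z
    proof -
      have zU: "(\<zeta>, z) \<in> U" and zV: "\<psi> \<zeta> z \<in> V" using z by (auto simp: U2_def U1_def)
      have "((\<lambda>z. (\<zeta>, z)) has_derivative (\<lambda>v. (0, v))) (at z)"
        by (intro has_derivative_Pair has_derivative_ident has_derivative_const)
      from has_derivative_compose[OF this has_derivative_\<psi>[OF zU]]
      have "(\<psi> \<zeta> has_derivative (\<lambda>v. psid \<psi> \<zeta> z (0, v))) (at z)" by simp
      from has_derivative_compose[OF this C1_onD(1)[OF smooth_on_imp_C1_on(1)[OF ph] zV]]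
      have "(pres ph \<psi> \<zeta> has_derivative (\<lambda>v. g (\<psi> \<zeta> z) \<bullet> psid \<psi> \<zeta> z (0, v))) (at z)"
        unfolding g[OF zV] pres_def .
      moreover have "g (\<psi> \<zeta> z) \<bullet> psid \<psi> \<zeta> z (0, v) = G z \<bullet> v" for v
        unfolding psid_eq[OF zU] G_def by (simp add: inner_add_right inner_complex_def[of "Complex _ _"])
      ultimately show ?thesis by simp
    qed
    have U21: "U2 \<subseteq> U1" by (auto simp: U2_def)
    show "continuous_on U2 G"
    proof -
      have 1: "continuous_on U2 (\<lambda>z. g (\<psi> \<zeta> z))"
        by (rule continuous_on_compose2[OF contg continuous_on_subset[OF cont\<psi> U21]]) (auto simp: U2_def)
      have 2: "continuous_on U2 (\<lambda>z. psid \<psi> \<zeta> z e_x)" "continuous_on U2 (\<lambda>z. psid \<psi> \<zeta> z e_y)"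
        using slice[OF C1_onD(3)[OF C1_psid, of e_x]] slice[OF C1_onD(3)[OF C1_psid, of e_y]]
        by (auto intro: continuous_on_subset[OF _ U21])
      show ?thesis unfolding G_def Complex_eq by (intro continuous_intros 1 2)
    qed
    show "pres ph \<psi> \<zeta> z = P0" if "z \<in> ?c" for z
      using that by (simp add: isobar_def)
    show "G z \<noteq> 0" if z: "z \<in> ?c" for z
    proof
      assume "G z = 0"
      then have 0: "g (\<psi> \<zeta> z) \<bullet> psid \<psi> \<zeta> z e_x = 0" "g (\<psi> \<zeta> z) \<bullet> psid \<psi> \<zeta> z e_y = 0"
        by (auto simp: G_def complex_eq_iff)
      have zU: "(\<zeta>, z) \<in> U" and zV: "\<psi> \<zeta> z \<in> V" using z c_sub by (auto simp: U2_def U1_def)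
      have "frechet_derivative ph (at (\<psi> \<zeta> z)) v = 0" for v
      proof -
        have "g (\<psi> \<zeta> z) \<bullet> v = g (\<psi> \<zeta> z) \<bullet> (Re (Dpsi_inv \<psi> \<zeta> z v) *\<^sub>R psid \<psi> \<zeta> z e_x + Im (Dpsi_inv \<psi> \<zeta> z v) *\<^sub>R psid \<psi> \<zeta> z e_y)"
          by (simp add: psid_Dpsi_inv[OF zU])
        also have "\<dots> = 0" using 0 by (simp add: inner_add_right)
        finally show ?thesis by (simp add: g[OF zV])
      qed
      then show False using regular[OF z] by auto
    qed
    have "continuous_on U1 (momentum X \<psi> \<zeta>)"
      using slice[OF C1_onD(3)[OF C1_momentum]] by simp
    then show "continuous_on ?c (\<lambda>z. cnj (momentum X \<psi> \<zeta> z))"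
      using c_sub U21 by (intro continuous_intros) (auto intro: continuous_on_subset)
  qed
  then obtain I where I: "((\<lambda>z. cnj (momentum X \<psi> \<zeta> z)) has_contour_integral I) \<delta>" "((\<lambda>z. cnj (momentum X \<psi> \<zeta> z)) has_contour_integral I) \<gamma>"
    by blast
  have Re_cnj: "Re (cnj m * v) = m \<bullet> v" for m v by (simp add: inner_complex_def)
  show ?thesis
    using I[unfolded has_contour_integral, THEN has_integral_Re] unfolding Re_cnj by blast
qed

end

section \<open>Transport of loops\<close>

locale transport = spatial_path +
  fixes a b :: real and R :: "complex set"
  assumes ab: "a \<le> b" and sub: "{a..b} \<times> unit_disc \<subseteq> U"
    and bij: "\<And>\<zeta>. \<zeta> \<in> {a..b} \<Longrightarrow> bij_betw (\<psi> \<zeta>) unit_disc R"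
begin

definition \<phi> :: "real \<Rightarrow> complex \<Rightarrow> complex" where "\<phi> \<zeta> = inv_into unit_disc (\<psi> \<zeta>)"

lemma \<phi>_in: "\<phi> \<zeta> q \<in> unit_disc" and \<psi>_\<phi>: "\<psi> \<zeta> (\<phi> \<zeta> q) = q" if "\<zeta> \<in> {a..b}" "q \<in> R"
  using bij[OF that(1)] that(2) unfolding \<phi>_def bij_betw_def
  by (auto simp: f_inv_into_f simp del: mem_cball intro!: inv_into_into)

lemma \<phi>_\<psi>: "\<phi> \<zeta> (\<psi> \<zeta> z) = z" if "\<zeta> \<in> {a..b}" "z \<in> unit_disc"
  using bij[OF that(1)] that(2) unfolding \<phi>_def bij_betw_def by (intro inv_into_f_f) auto

lemma \<psi>_in: "\<psi> \<zeta> z \<in> R" if "\<zeta> \<in> {a..b}" "z \<in> unit_disc"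
  using bij[OF that(1)] that(2) by (auto simp: bij_betw_def)

lemma inU: "(\<zeta>, z) \<in> U" if "\<zeta> \<in> {a..b}" "z \<in> unit_disc"
  using that sub by auto

lemma image_suspension: "(\<lambda>x. (fst x, \<psi> (fst x) (snd x))) ` ({a..b} \<times> unit_disc) = {a..b} \<times> R"
proof safe
  fix \<zeta> q assume "\<zeta> \<in> {a..b}" "q \<in> R"
  then show "(\<zeta>, q) \<in> (\<lambda>x. (fst x, \<psi> (fst x) (snd x))) ` ({a..b} \<times> unit_disc)"
    using \<phi>_in[of \<zeta> q] \<psi>_\<phi>[of \<zeta> q] by (intro image_eqI[of _ _ "(\<zeta>, \<phi> \<zeta> q)"]) auto
qed (use \<psi>_in in auto)

lemma continuous_on_\<psi>: "continuous_on ({a..b} \<times> unit_disc) (\<lambda>x. \<psi> (fst x) (snd x))"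
  using continuous_on_subset[OF C1_onD(3)[OF C1_\<psi>] sub] by (simp add: case_prod_unfold)

lemma continuous_on_\<phi>: "continuous_on ({a..b} \<times> R) (\<lambda>x. \<phi> (fst x) (snd x))"
proof -
  have "continuous_on ((\<lambda>x. (fst x, \<psi> (fst x) (snd x))) ` ({a..b} \<times> unit_disc)) (\<lambda>x. (fst x, \<phi> (fst x) (snd x)))"
    by (rule continuous_on_inv)
      (auto intro!: continuous_intros continuous_on_\<psi> compact_Times \<phi>_\<psi>)
  from continuous_on_snd[OF this] show ?thesis by (simp add: image_suspension)
qed

lemma has_derivative_\<phi>:
  assumes \<zeta>: "\<zeta> \<in> {a..b}" and q: "q \<in> R"
  shows "((\<lambda>x. \<phi> (fst x) (snd x)) has_derivative
     (\<lambda>v. fst v *\<^sub>R vel_u \<psi> \<zeta> (\<phi> \<zeta> q) + Dpsi_inv \<psi> \<zeta> (\<phi> \<zeta> q) (snd v))) (at (\<zeta>, q) within {a..b} \<times> R)"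
proof -
  define z where "z = \<phi> \<zeta> q"
  have z: "z \<in> unit_disc" "\<psi> \<zeta> z = q" "(\<zeta>, z) \<in> U"
    using \<phi>_in[OF assms] \<psi>_\<phi>[OF assms] inU[OF \<zeta>] by (auto simp: z_def)
  let ?f = "\<lambda>x. (fst x, \<psi> (fst x) (snd x))" and ?g = "\<lambda>x. (fst x, \<phi> (fst x) (snd x))"
  have "(?g has_derivative (\<lambda>v. (fst v, fst v *\<^sub>R vel_u \<psi> \<zeta> z + Dpsi_inv \<psi> \<zeta> z (snd v))))
      (at (?f (\<zeta>, z)) within ?f ` ({a..b} \<times> unit_disc))"
  proof (rule has_derivative_inverse_within)
    show "(?f has_derivative (\<lambda>v. (fst v, psid \<psi> \<zeta> z v))) (at (\<zeta>, z) within {a..b} \<times> unit_disc)"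
      by (intro has_derivative_Pair has_derivative_at_withinI[OF has_derivative_\<psi>] z(3)) (auto intro!: derivative_eq_intros)
    show "continuous (at (?f (\<zeta>, z)) within ?f ` ({a..b} \<times> unit_disc)) ?g"
      unfolding image_suspension
      using continuous_on_\<phi> \<zeta> q z by (auto simp: continuous_on_eq_continuous_within intro!: continuous_intros)
    show "linear (\<lambda>v. (fst v, fst v *\<^sub>R vel_u \<psi> \<zeta> z + Dpsi_inv \<psi> \<zeta> z (snd v)))"
      using linear_Dpsi_inv[of \<zeta> z]
      by (intro linearI) (auto simp: linear_add linear_scale algebra_simps scaleR_add_left)
    have "fst v *\<^sub>R vel_u \<psi> \<zeta> z + Dpsi_inv \<psi> \<zeta> z (psid \<psi> \<zeta> z v) = snd v" for v
    proof -
      obtain \<alpha> w where v: "v = (\<alpha>, w)" by (cases v)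
      have "psid \<psi> \<zeta> z v = \<alpha> *\<^sub>R psid \<psi> \<zeta> z e_zeta + psid \<psi> \<zeta> z (0, w)"
        unfolding v psid_eq[OF z(3), of \<alpha>] psid_eq[OF z(3), of 0] by simp
      then have "Dpsi_inv \<psi> \<zeta> z (psid \<psi> \<zeta> z v) = - \<alpha> *\<^sub>R vel_u \<psi> \<zeta> z + Dpsi_inv \<psi> \<zeta> z (psid \<psi> \<zeta> z (0, w))"
        using linear_Dpsi_inv[of \<zeta> z] by (simp add: linear_add linear_scale vel_u_eq)
      moreover have "Dpsi_inv \<psi> \<zeta> z (psid \<psi> \<zeta> z (0, w)) = w"
        by (rule Dpsi_inv_unique[OF z(3)]) (simp add: psid_eq[OF z(3), of 0])
      ultimately show ?thesis by (simp add: v)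
    qed
    then show "(\<lambda>v. (fst v, fst v *\<^sub>R vel_u \<psi> \<zeta> z + Dpsi_inv \<psi> \<zeta> z (snd v))) \<circ> (\<lambda>v. (fst v, psid \<psi> \<zeta> z v)) = id"
      by (auto simp: fun_eq_iff)
  qed (use \<zeta> z \<phi>_\<psi> in auto)
  from has_derivative_snd[OF this] show ?thesis
    unfolding image_suspension by (simp add: z(2) z_def[symmetric])
qed

lemma vector_derivative_\<phi>_time:
  assumes "\<zeta> \<in> {a..b}" and "q \<in> R"
  shows "((\<lambda>\<zeta>. \<phi> \<zeta> q) has_vector_derivative vel_u \<psi> \<zeta> (\<phi> \<zeta> q)) (at \<zeta> within {a..b})"
proof -
  have 1: "((\<lambda>s. (s, q)) has_derivative (\<lambda>h. (h, 0))) (at \<zeta> within {a..b})"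
    by (intro has_derivative_Pair has_derivative_ident has_derivative_const)
  have "((\<lambda>x. \<phi> (fst x) (snd x)) has_derivative
     (\<lambda>v. fst v *\<^sub>R vel_u \<psi> \<zeta> (\<phi> \<zeta> q) + Dpsi_inv \<psi> \<zeta> (\<phi> \<zeta> q) (snd v))) (at (\<zeta>, q) within (\<lambda>s. (s, q)) ` {a..b})"
    by (rule has_derivative_subset[OF has_derivative_\<phi>]) (use assms in auto)
  from has_derivative_in_compose[OF 1 this] show ?thesis
    by (simp add: has_vector_derivative_def linear_0[OF linear_Dpsi_inv])
qed

lemma vector_derivative_\<phi>_space:
  assumes \<zeta>: "\<zeta> \<in> {a..b}" and I: "open I" "t \<in> I" "\<sigma> ` I \<subseteq> R" and \<sigma>: "(\<sigma> has_vector_derivative \<sigma>') (at t)"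
  shows "((\<lambda>t. \<phi> \<zeta> (\<sigma> t)) has_vector_derivative Dpsi_inv \<psi> \<zeta> (\<phi> \<zeta> (\<sigma> t)) \<sigma>') (at t)"
proof -
  have 1: "((\<lambda>s. (\<zeta>, \<sigma> s)) has_derivative (\<lambda>h. (0, h *\<^sub>R \<sigma>'))) (at t within I)"
    using \<sigma> by (intro has_derivative_Pair has_derivative_const) (auto simp: has_vector_derivative_def intro: has_derivative_at_withinI)
  have "((\<lambda>x. \<phi> (fst x) (snd x)) has_derivative
     (\<lambda>v. fst v *\<^sub>R vel_u \<psi> \<zeta> (\<phi> \<zeta> (\<sigma> t)) + Dpsi_inv \<psi> \<zeta> (\<phi> \<zeta> (\<sigma> t)) (snd v))) (at (\<zeta>, \<sigma> t) within (\<lambda>s. (\<zeta>, \<sigma> s)) ` I)"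
    by (rule has_derivative_subset[OF has_derivative_\<phi>]) (use \<zeta> I in auto)
  from has_derivative_in_compose[OF 1 this] show ?thesis
    using I by (simp add: has_vector_derivative_def linear_scale[OF linear_Dpsi_inv] at_within_open[of t I])
qed

lemma vector_derivative_along_flow:
  fixes F :: "real \<times> complex \<Rightarrow> 'c::real_normed_vector"
  assumes F: "C1_on U F" and \<zeta>: "\<zeta> \<in> {a..b}" and q: "q \<in> R"
  shows "((\<lambda>\<zeta>. F (\<zeta>, \<phi> \<zeta> q)) has_vector_derivative
     frechet_derivative F (at (\<zeta>, \<phi> \<zeta> q)) (1, vel_u \<psi> \<zeta> (\<phi> \<zeta> q))) (at \<zeta> within {a..b})"
proof -
  have D: "(F has_derivative frechet_derivative F (at (\<zeta>, \<phi> \<zeta> q))) (at (\<zeta>, \<phi> \<zeta> q))"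
    by (rule C1_onD(1)[OF F inU[OF \<zeta> \<phi>_in[OF \<zeta> q]]])
  have "((\<lambda>\<zeta>. (\<zeta>, \<phi> \<zeta> q)) has_derivative (\<lambda>h. (h, h *\<^sub>R vel_u \<psi> \<zeta> (\<phi> \<zeta> q)))) (at \<zeta> within {a..b})"
    using vector_derivative_\<phi>_time[OF \<zeta> q] unfolding has_vector_derivative_def
    by (intro has_derivative_Pair has_derivative_ident)
  from has_derivative_compose[OF this D]
  have "((\<lambda>\<zeta>. F (\<zeta>, \<phi> \<zeta> q)) has_derivative (\<lambda>h. frechet_derivative F (at (\<zeta>, \<phi> \<zeta> q)) (h *\<^sub>R (1, vel_u \<psi> \<zeta> (\<phi> \<zeta> q))))) (at \<zeta> within {a..b})"
    by simp
  then show ?thesis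
    unfolding has_vector_derivative_def linear_scale[OF has_derivative_linear[OF D]] .
qed

lemma momentum_along_flow:
  assumes \<zeta>: "\<zeta> \<in> {a..b}" and q: "q \<in> R" and EL: "EL_eq X ph \<psi> \<zeta> (\<phi> \<zeta> q)"
    and p: "(\<lambda>(s, w). pres ph \<psi> s w) differentiable (at (\<zeta>, \<phi> \<zeta> q))"
    and tangent: "frechet_derivative (\<lambda>(s, w). pres ph \<psi> s w) (at (\<zeta>, \<phi> \<zeta> q)) (0, Dpsi_inv \<psi> \<zeta> (\<phi> \<zeta> q) v) = 0"
  shows "((\<lambda>\<zeta>. momentum X \<psi> \<zeta> (\<phi> \<zeta> q) \<bullet> Dpsi_inv \<psi> \<zeta> (\<phi> \<zeta> q) v) has_vector_derivative
     frechet_derivative (\<lambda>(s, w). energy_term X \<psi> s w) (at (\<zeta>, \<phi> \<zeta> q)) (0, Dpsi_inv \<psi> \<zeta> (\<phi> \<zeta> q) v)) (at \<zeta> within {a..b})"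
proof -
  have x: "(\<zeta>, \<phi> \<zeta> q) \<in> U" by (rule inU[OF \<zeta> \<phi>_in[OF \<zeta> q]])
  note 1 = vector_derivative_along_flow[OF C1_momentum \<zeta> q, unfolded prod.case]
  note 2 = vector_derivative_along_flow[OF C1_Dpsi_inv \<zeta> q, unfolded fst_conv snd_conv, of v]
  from bounded_bilinear.has_vector_derivative[OF bounded_bilinear_inner 1 2]
  show ?thesis
    unfolding Dpsi_inv_along_flow[OF x] EL_along_flow[OF x EL p tangent, symmetric] by (simp add: add.commute)
qed

definition transported :: "(real \<Rightarrow> complex) \<Rightarrow> real \<Rightarrow> real \<Rightarrow> complex" where
  "transported \<gamma> \<zeta> t = \<phi> \<zeta> (\<psi> a (\<gamma> t))"

lemma transported_start: "\<gamma> t \<in> unit_disc \<Longrightarrow> transported \<gamma> a t = \<gamma> t"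
  using \<phi>_\<psi>[of a "\<gamma> t"] ab by (simp add: transported_def)

lemma transported_in: "\<zeta> \<in> {a..b} \<Longrightarrow> \<gamma> t \<in> unit_disc \<Longrightarrow> transported \<gamma> \<zeta> t \<in> unit_disc"
  unfolding transported_def using ab by (intro \<phi>_in \<psi>_in) auto

lemma \<psi>_transported: "\<zeta> \<in> {a..b} \<Longrightarrow> \<gamma> t \<in> unit_disc \<Longrightarrow> \<psi> \<zeta> (transported \<gamma> \<zeta> t) = \<psi> a (\<gamma> t)"
  unfolding transported_def using ab by (intro \<psi>_\<phi> \<psi>_in) auto

lemma continuous_on_transported:
  assumes "continuous_on T \<gamma>" "\<gamma> ` T \<subseteq> unit_disc"
  shows "continuous_on ({a..b} \<times> T) (\<lambda>x. transported \<gamma> (fst x) (snd x))"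
proof -
  have "continuous_on ({a..b} \<times> T) (\<lambda>x. \<gamma> (snd x))"
    by (rule continuous_on_compose2[OF assms(1)]) (auto intro!: continuous_intros)
  then have "continuous_on ({a..b} \<times> T) (\<lambda>x. (\<lambda>y. \<psi> (fst y) (snd y)) (a, \<gamma> (snd x)))"
    using assms(2) ab by (intro continuous_on_compose2[OF continuous_on_\<psi>]) (auto intro!: continuous_intros)
  then have "continuous_on ({a..b} \<times> T) (\<lambda>x. (\<lambda>y. \<phi> (fst y) (snd y)) (fst x, \<psi> a (\<gamma> (snd x))))"
    using assms(2) ab by (intro continuous_on_compose2[OF continuous_on_\<phi>]) (auto intro!: continuous_intros \<psi>_in)
  then show ?thesis by (simp add: transported_def)
qed

lemma transported_simple_loop:
  assumes \<gamma>: "simple_path \<gamma>" "pathfinish \<gamma> = pathstart \<gamma>" "path_image \<gamma> \<subseteq> unit_disc"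
    and w: "w \<notin> path_image \<gamma>" "winding_number \<gamma> w = 1"
  shows "simple_path (transported \<gamma> b)" "pathfinish (transported \<gamma> b) = pathstart (transported \<gamma> b)"
    "\<exists>w. w \<notin> path_image (transported \<gamma> b) \<and> winding_number (transported \<gamma> b) w = 1"
proof -
  have path: "path \<gamma>" using \<gamma>(1) by (simp add: simple_path_imp_path)
  have disc: "\<gamma> t \<in> unit_disc" if "t \<in> {0..1}" for t
    using \<gamma>(3) that by (auto simp: path_image_def simp del: mem_cball mem_cball_0)
  have cont: "continuous_on ({a..b} \<times> {0..1}) (\<lambda>x. transported \<gamma> (fst x) (snd x))"
    using path disc by (intro continuous_on_transported) (auto simp: path_def)
  have inj: "\<gamma> s = z" if "\<zeta> \<in> {a..b}" "s \<in> {0..1}" "z \<in> unit_disc" "transported \<gamma> \<zeta> s = \<phi> \<zeta> (\<psi> a z)" for \<zeta> s z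
  proof -
    have "\<psi> a (\<gamma> s) = \<psi> a z"
      using that \<psi>_transported[of \<zeta> \<gamma> s] \<psi>_\<phi>[of \<zeta> "\<psi> a z"] \<psi>_in[of a z] disc[of s] ab by auto
    then show ?thesis
      using \<phi>_\<psi>[of a z] \<phi>_\<psi>[of a "\<gamma> s"] disc[of s] that ab by auto
  qed
  show loop: "pathfinish (transported \<gamma> b) = pathstart (transported \<gamma> b)"
    using \<gamma>(2) by (simp add: pathfinish_def pathstart_def transported_def)
  have "path (transported \<gamma> b)"
    unfolding path_def using ab
    by (intro continuous_on_compose2[OF cont, of _ "\<lambda>t. (b, t)", simplified]) (auto intro!: continuous_intros)
  moreover have "loop_free (transported \<gamma> b)"
    unfolding loop_free_def
  proof (intro ballI impI)
    fix s t :: real assume st: "s \<in> {0..1}" "t \<in> {0..1}" "transported \<gamma> b s = transported \<gamma> b t"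
    then have "\<gamma> s = \<gamma> t"
      using inj[of b s "\<gamma> t"] disc[of t] ab by (simp add: transported_def)
    then show "s = t \<or> s = 0 \<and> t = 1 \<or> s = 1 \<and> t = 0"
      using \<gamma>(1) st by (auto simp: simple_path_def loop_free_def)
  qed
  ultimately show "simple_path (transported \<gamma> b)" by (simp add: simple_path_def)
  have wD: "w \<in> unit_disc"
    using winding_number_zero_outside[OF path convex_cball \<gamma>(2) _ \<gamma>(3)] w by fastforce
  define W where "W = (\<lambda>\<zeta>. \<phi> \<zeta> (\<psi> a w))"
  have avoid: "transported \<gamma> \<zeta> t \<noteq> W \<zeta>" if "\<zeta> \<in> {a..b}" "t \<in> {0..1}" for \<zeta> t
    using inj[of \<zeta> t w] that wD w(1) by (auto simp: W_def path_image_def)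
  have contW: "continuous_on {a..b} W"
    unfolding W_def using \<psi>_in[of a w] wD ab
    by (intro continuous_on_compose2[OF continuous_on_\<phi>, of _ "\<lambda>\<zeta>. (\<zeta>, \<psi> a w)", simplified]) (auto intro!: continuous_intros)
  define l where "l = (\<lambda>s. a + s * (b - a))"
  have l: "l s \<in> {a..b}" if "s \<in> {0..1}" for s
    using that ab mult_right_mono[of s 1 "b - a"] by (auto simp: l_def)
  have "homotopic_loops (-{0}) (\<lambda>t. \<gamma> t - w) (\<lambda>t. transported \<gamma> b t - W b)"
    unfolding homotopic_loops
  proof (intro exI conjI)
    let ?h = "\<lambda>x. transported \<gamma> (l (fst x)) (snd x) - W (l (fst x))"
    have cl: "continuous_on ({0..1} \<times> {0..1}) (\<lambda>x::real \<times> real. l (fst x))"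
      unfolding l_def by (intro continuous_intros)
    show "continuous_on ({0..1} \<times> {0..1}) ?h"
    proof (intro continuous_on_diff)
      show "continuous_on ({0..1} \<times> {0..1}) (\<lambda>x::real \<times> real. W (l (fst x)))"
        by (rule continuous_on_compose2[OF contW cl]) (use l in auto)
      show "continuous_on ({0..1} \<times> {0..1}) (\<lambda>x. transported \<gamma> (l (fst x)) (snd x))"
        by (rule continuous_on_compose2[OF cont, of _ "\<lambda>x. (l (fst x), snd x)", simplified])
          (use l in \<open>auto intro!: continuous_intros cl\<close>)
    qed
    show "?h \<in> {0..1} \<times> {0..1} \<rightarrow> - {0}"
      using l avoid by auto
    show "\<forall>t\<in>{0..1}. ?h (0, t) = \<gamma> t - w"
      using transported_start[OF disc] \<phi>_\<psi>[of a w] wD ab by (auto simp: l_def W_def)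
    show "\<forall>t\<in>{0..1}. ?h (1, t) = transported \<gamma> b t - W b"
      by (simp add: l_def)
    show "\<forall>t\<in>{0..1}. pathfinish (?h \<circ> Pair t) = pathstart (?h \<circ> Pair t)"
      using \<gamma>(2) by (simp add: pathfinish_def pathstart_def transported_def)
  qed
  then have "winding_number (transported \<gamma> b) (W b) = winding_number \<gamma> w"
    using winding_number_homotopic_loops winding_number_offset by metis
  moreover have "W b \<notin> path_image (transported \<gamma> b)"
    using avoid[of b] ab unfolding path_image_def by fastforce
  ultimately show "\<exists>w. w \<notin> path_image (transported \<gamma> b) \<and> winding_number (transported \<gamma> b) w = 1"
    using w by auto
qed

lemma path_image_transported_isobar:
  assumes "path_image \<gamma> = isobar ph \<psi> a P0"
  shows "path_image (transported \<gamma> b) = isobar ph \<psi> b P0"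
proof -
  have img: "path_image (transported \<gamma> b) = (\<lambda>z. \<phi> b (\<psi> a z)) ` isobar ph \<psi> a P0"
    unfolding assms[symmetric] path_image_def transported_def by auto
  show ?thesis
  proof (intro equalityI subsetI)
    fix z assume "z \<in> path_image (transported \<gamma> b)"
    then show "z \<in> isobar ph \<psi> b P0"
      using \<phi>_in[of b] \<psi>_\<phi>[of b] \<psi>_in[of a] ab unfolding img isobar_def pres_def by (auto simp del: mem_cball)
  next
    fix z assume z: "z \<in> isobar ph \<psi> b P0"
    then have "z \<in> unit_disc" "ph (\<psi> b z) = P0" by (auto simp: isobar_def pres_def)
    moreover from this have "\<phi> a (\<psi> b z) \<in> unit_disc" "\<psi> a (\<phi> a (\<psi> b z)) = \<psi> b z"
      using \<phi>_in[of a] \<psi>_\<phi>[of a] \<psi>_in[of b z] ab by auto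
    ultimately show "z \<in> path_image (transported \<gamma> b)"
      unfolding img isobar_def pres_def using \<phi>_\<psi>[of b z] ab
      by (intro image_eqI[of _ _ "\<phi> a (\<psi> b z)"]) auto
  qed
qed

text \<open>
  Pointwise in \<open>t\<close>, the difference of the two circulation densities is the \<open>t\<close>-derivative of
  \<open>K t = \<integral>\<^sub>a\<^sup>b E (\<zeta>, \<Gamma> \<zeta> t) d\<zeta>\<close>, and \<open>K\<close> takes equal values at both ends of a loop. Arguing with \<open>K\<close>
  avoids differentiating the circulation under the integral over \<open>t\<close>, whose integrand may be unbounded.
\<close>

lemma transported_circulation:
  assumes \<gamma>: "valid_path \<gamma>" "pathfinish \<gamma> = pathstart \<gamma>" "path_image \<gamma> \<subseteq> unit_disc"
    and ph: "\<And>q. q \<in> R \<Longrightarrow> ph differentiable (at q)"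
    and level: "\<And>t. t \<in> {0..1} \<Longrightarrow> ph (\<psi> a (\<gamma> t)) = P0"
    and EL: "\<And>\<zeta> z. \<zeta> \<in> {a..b} \<Longrightarrow> z \<in> unit_disc \<Longrightarrow> EL_eq X ph \<psi> \<zeta> z"
  shows "valid_path (transported \<gamma> b)"
    "((\<lambda>t. momentum X \<psi> b (transported \<gamma> b t) \<bullet> vector_derivative (transported \<gamma> b) (at t)
         - momentum X \<psi> a (\<gamma> t) \<bullet> vector_derivative \<gamma> (at t)) has_integral 0) {0..1}"
proof -
  obtain S where S: "finite S" "\<gamma> C1_differentiable_on {0..1} - S" and cont\<gamma>: "continuous_on {0..1} \<gamma>"
    using \<gamma> by (auto simp: valid_path_def piecewise_C1_differentiable_on_def)
  define I where "I = {0<..<1} - S"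
  have I: "open I" "I \<subseteq> {0<..<1}" "I \<subseteq> {0..1}"
    using S(1) by (auto simp: I_def intro!: open_Diff finite_imp_closed)
  define \<gamma>' where "\<gamma>' = (\<lambda>t. vector_derivative \<gamma> (at t))"
  define \<Gamma> where "\<Gamma> = transported \<gamma>"
  have d\<gamma>: "(\<gamma> has_vector_derivative \<gamma>' t) (at t)" if "t \<in> I" for t
    using S(2) that unfolding C1_differentiable_on_eq \<gamma>'_def I_def by (auto simp: vector_derivative_works)
  have cont\<gamma>': "continuous_on I \<gamma>'"
    using S(2) unfolding C1_differentiable_on_eq \<gamma>'_def I_def by (auto elim: continuous_on_subset)
  have disc: "\<gamma> t \<in> unit_disc" if "t \<in> {0..1}" for t
    using \<gamma>(3) that by (auto simp: path_image_def simp del: mem_cball mem_cball_0)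
  have disc_img: "\<gamma> ` {0..1} \<subseteq> unit_disc"
    using \<gamma>(3) by (simp add: path_image_def)
  have aI: "a \<in> {a..b}" and bI: "b \<in> {a..b}" using ab by auto
  have \<Gamma>U: "(\<zeta>, \<Gamma> \<zeta> t) \<in> U" if "\<zeta> \<in> {a..b}" "t \<in> {0..1}" for \<zeta> t
    unfolding \<Gamma>_def by (intro inU transported_in disc that)
  have \<Gamma>a: "\<Gamma> a t = \<gamma> t" if "t \<in> {0..1}" for t
    unfolding \<Gamma>_def using transported_start[of \<gamma> t, OF disc[OF that]] .
  have cont\<Gamma>: "continuous_on ({a..b} \<times> {0..1}) (\<lambda>x. (fst x, \<Gamma> (fst x) (snd x)))"
    unfolding \<Gamma>_def by (intro continuous_intros continuous_on_transported cont\<gamma> disc_img)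
  have contF: "continuous_on ({a..b} \<times> T) (\<lambda>x. F (fst x, \<Gamma> (fst x) (snd x)))"
    if "continuous_on U F" "T \<subseteq> {0..1}" for F :: "real \<times> complex \<Rightarrow> 'c::real_normed_vector" and T
    by (rule continuous_on_compose2[OF that(1) continuous_on_subset[OF cont\<Gamma>]]) (use that \<Gamma>U in auto)
  define \<sigma>' where "\<sigma>' = (\<lambda>t. psid \<psi> a (\<gamma> t) (0, \<gamma>' t))"
  have d\<sigma>: "((\<lambda>t. \<psi> a (\<gamma> t)) has_vector_derivative \<sigma>' t) (at t)" if t: "t \<in> I" for t
  proof -
    have U: "(a, \<gamma> t) \<in> U" using t I(3) by (intro inU disc aI) auto
    note D = has_derivative_\<psi>[OF U]
    have "((\<lambda>t. (a, \<gamma> t)) has_derivative (\<lambda>h. (0, h *\<^sub>R \<gamma>' t))) (at t)"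
      using d\<gamma>[OF t] by (intro has_derivative_Pair has_derivative_const) (simp add: has_vector_derivative_def)
    from has_derivative_compose[OF this D]
    have "((\<lambda>t. \<psi> a (\<gamma> t)) has_derivative (\<lambda>h. psid \<psi> a (\<gamma> t) (h *\<^sub>R (0, \<gamma>' t)))) (at t)" by simp
    then show ?thesis
      unfolding has_vector_derivative_def linear_scale[OF has_derivative_linear[OF D]] \<sigma>'_def .
  qed
  have cont\<sigma>': "continuous_on I \<sigma>'"
  proof -
    have g: "continuous_on I (\<lambda>t. psid \<psi> a (\<gamma> t) v)" for v
      using I(3) disc inU[OF aI]
      by (intro continuous_on_compose2[OF C1_onD(3)[OF C1_psid, of v], of I "\<lambda>t. (a, \<gamma> t)", unfolded fst_conv snd_conv])
        (auto intro!: continuous_intros continuous_on_subset[OF cont\<gamma>] simp del: mem_cball mem_cball_0)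
    have "continuous_on I (\<lambda>t. Re (\<gamma>' t) *\<^sub>R psid \<psi> a (\<gamma> t) e_x + Im (\<gamma>' t) *\<^sub>R psid \<psi> a (\<gamma> t) e_y)"
      by (intro continuous_intros cont\<gamma>' g)
    then show ?thesis
    proof (rule continuous_on_eq)
      fix t assume "t \<in> I"
      then have "(a, \<gamma> t) \<in> U" using I(3) by (intro inU disc aI) auto
      then show "Re (\<gamma>' t) *\<^sub>R psid \<psi> a (\<gamma> t) e_x + Im (\<gamma>' t) *\<^sub>R psid \<psi> a (\<gamma> t) e_y = \<sigma>' t"
        by (simp add: \<sigma>'_def psid_eq[of a "\<gamma> t" 0])
    qed
  qed
  define W where "W = (\<lambda>\<zeta> t. Dpsi_inv \<psi> \<zeta> (\<Gamma> \<zeta> t) (\<sigma>' t))"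
  have contW: "continuous_on ({a..b} \<times> I) (\<lambda>x. W (fst x) (snd x))"
  proof -
    have "continuous_on ({a..b} \<times> I) (\<lambda>x. Dpsi_inv \<psi> (fst x) (\<Gamma> (fst x) (snd x)) v)" for v
      using contF[OF C1_onD(3)[OF C1_Dpsi_inv, of v] I(3)] by simp
    moreover have "continuous_on ({a..b} \<times> I) (\<lambda>x. \<sigma>' (snd x))"
      by (rule continuous_on_compose2[OF cont\<sigma>']) (auto intro!: continuous_intros)
    ultimately show ?thesis
      unfolding W_def Dpsi_inv_coordinates[of _ _ "\<sigma>' _"] by (intro continuous_intros)
  qed
  have d\<Gamma>: "(\<Gamma> \<zeta> has_vector_derivative W \<zeta> t) (at t)" if "\<zeta> \<in> {a..b}" "t \<in> I" for \<zeta> t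
  proof -
    have "(\<lambda>t. \<psi> a (\<gamma> t)) ` I \<subseteq> R" using I(3) disc by (auto intro!: \<psi>_in aI simp del: mem_cball mem_cball_0)
    from vector_derivative_\<phi>_space[OF that(1) I(1) that(2) this d\<sigma>[OF that(2)]]
    show ?thesis by (simp add: W_def \<Gamma>_def transported_def[abs_def])
  qed
  have dF: "((\<lambda>t. F (\<zeta>, \<Gamma> \<zeta> t)) has_vector_derivative F' (0, W \<zeta> t)) (at t)"
    if "(F has_derivative F') (at (\<zeta>, \<Gamma> \<zeta> t))" "\<zeta> \<in> {a..b}" "t \<in> I"
    for F :: "real \<times> complex \<Rightarrow> real" and F' \<zeta> t
  proof -
    have "((\<lambda>t. (\<zeta>, \<Gamma> \<zeta> t)) has_derivative (\<lambda>h. (0, h *\<^sub>R W \<zeta> t))) (at t)"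
      using d\<Gamma>[OF that(2,3)] by (intro has_derivative_Pair has_derivative_const) (simp add: has_vector_derivative_def)
    from has_derivative_compose[OF this that(1)]
    have "((\<lambda>t. F (\<zeta>, \<Gamma> \<zeta> t)) has_derivative (\<lambda>h. F' (h *\<^sub>R (0, W \<zeta> t)))) (at t)" by simp
    then show ?thesis
      unfolding has_vector_derivative_def linear_scale[OF has_derivative_linear[OF that(1)]] .
  qed
  have pres_diff: "(\<lambda>(s, w). pres ph \<psi> s w) differentiable (at (\<zeta>, z))" if "\<zeta> \<in> {a..b}" "z \<in> unit_disc" for \<zeta> z
  proof -
    have "ph differentiable (at (\<psi> \<zeta> z))" by (intro ph \<psi>_in that)
    moreover have "(\<lambda>x. \<psi> (fst x) (snd x)) differentiable (at (\<zeta>, z))"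
      using has_derivative_\<psi>[OF inU[OF that]] by (auto simp: differentiable_def)
    ultimately show ?thesis
      using differentiable_chain_at[of "\<lambda>x. \<psi> (fst x) (snd x)" "(\<zeta>, z)" ph]
      by (simp add: o_def pres_def case_prod_unfold)
  qed
  have tangent: "frechet_derivative (\<lambda>(s, w). pres ph \<psi> s w) (at (\<zeta>, \<Gamma> \<zeta> t)) (0, W \<zeta> t) = 0"
    if "\<zeta> \<in> {a..b}" "t \<in> I" for \<zeta> t
  proof -
    have "\<Gamma> \<zeta> t \<in> unit_disc" unfolding \<Gamma>_def using that I(3) by (intro transported_in disc) auto
    from dF[OF _ that, of "\<lambda>(s, w). pres ph \<psi> s w"] pres_diff[OF that(1) this]
    have "((\<lambda>t. pres ph \<psi> \<zeta> (\<Gamma> \<zeta> t)) has_vector_derivative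
        frechet_derivative (\<lambda>(s, w). pres ph \<psi> s w) (at (\<zeta>, \<Gamma> \<zeta> t)) (0, W \<zeta> t)) (at t)"
      by (simp add: frechet_derivative_works)
    moreover have "((\<lambda>t. pres ph \<psi> \<zeta> (\<Gamma> \<zeta> t)) has_vector_derivative 0) (at t)"
    proof (rule has_vector_derivative_transform_within_open[of "\<lambda>_. P0" _ _ I])
      fix s assume "s \<in> I"
      then show "P0 = pres ph \<psi> \<zeta> (\<Gamma> \<zeta> s)"
        using \<psi>_transported[of \<zeta> \<gamma> s] that(1) disc[of s] level[of s] I(3) by (auto simp: pres_def \<Gamma>_def)
    qed (use I that in auto)
    ultimately show ?thesis by (rule vector_derivative_unique_at)
  qed
  define E where "E = (\<lambda>(s, w). energy_term X \<psi> s w)"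
  define dE where "dE = (\<lambda>\<zeta> t. frechet_derivative E (at (\<zeta>, \<Gamma> \<zeta> t)) (0, W \<zeta> t))"
  have C1_E: "C1_on U E" unfolding E_def by (rule C1_energy_term)
  have E': "(E has_derivative frechet_derivative E (at (\<zeta>, \<Gamma> \<zeta> t))) (at (\<zeta>, \<Gamma> \<zeta> t))"
    if "\<zeta> \<in> {a..b}" "t \<in> {0..1}" for \<zeta> t
    by (rule C1_onD(1)[OF C1_E \<Gamma>U[OF that]])
  have cont_dE: "continuous_on ({a..b} \<times> I) (\<lambda>x. dE (fst x) (snd x))"
  proof -
    have "continuous_on ({a..b} \<times> I) (\<lambda>x. Re (W (fst x) (snd x)) * frechet_derivative E (at (fst x, \<Gamma> (fst x) (snd x))) e_x
        + Im (W (fst x) (snd x)) * frechet_derivative E (at (fst x, \<Gamma> (fst x) (snd x))) e_y)"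
      by (intro continuous_intros contW contF[OF C1_onD(2)[OF C1_E] I(3)])
    then show ?thesis
    proof (rule continuous_on_eq)
      fix x assume "x \<in> {a..b} \<times> I"
      then have "linear (frechet_derivative E (at (fst x, \<Gamma> (fst x) (snd x))))"
        using I(3) by (intro has_derivative_linear[OF E']) auto
      from linear_coordinates[OF this, of 0]
      show "Re (W (fst x) (snd x)) * frechet_derivative E (at (fst x, \<Gamma> (fst x) (snd x))) e_x
        + Im (W (fst x) (snd x)) * frechet_derivative E (at (fst x, \<Gamma> (fst x) (snd x))) e_y = dE (fst x) (snd x)"
        by (simp add: dE_def)
    qed
  qed
  have flow: "((\<lambda>\<zeta>. dE \<zeta> t) has_integral momentum X \<psi> b (\<Gamma> b t) \<bullet> W b t - momentum X \<psi> a (\<Gamma> a t) \<bullet> W a t) {a..b}"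
    if t: "t \<in> I" for t
  proof (rule fundamental_theorem_of_calculus[OF ab])
    fix \<zeta> assume \<zeta>: "\<zeta> \<in> {a..b}"
    have q: "\<psi> a (\<gamma> t) \<in> R" using t I(3) by (intro \<psi>_in aI disc) auto
    have \<Gamma>q: "\<Gamma> \<zeta> t = \<phi> \<zeta> (\<psi> a (\<gamma> t))" for \<zeta> by (simp add: \<Gamma>_def transported_def)
    show "((\<lambda>\<zeta>. momentum X \<psi> \<zeta> (\<Gamma> \<zeta> t) \<bullet> W \<zeta> t) has_vector_derivative dE \<zeta> t) (at \<zeta> within {a..b})"
      using momentum_along_flow[OF \<zeta> q EL[OF \<zeta> \<phi>_in[OF \<zeta> q]] pres_diff[OF \<zeta> \<phi>_in[OF \<zeta> q]], of "\<sigma>' t"]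
        tangent[OF \<zeta> t]
      unfolding W_def \<Gamma>q dE_def E_def by blast
  qed
  define K where "K = (\<lambda>t. integral (cbox a b) (\<lambda>\<zeta>. E (\<zeta>, \<Gamma> \<zeta> t)))"
  have contE: "continuous_on ({0..1} \<times> cbox a b) (\<lambda>(t, \<zeta>). E (\<zeta>, \<Gamma> \<zeta> t))"
    unfolding case_prod_unfold cbox_interval
    by (intro continuous_on_compose2[OF contF[OF C1_onD(3)[OF C1_E] order_refl], of _ "\<lambda>x. (snd x, fst x)", unfolded fst_conv snd_conv])
      (auto intro!: continuous_intros)
  have contK: "continuous_on {0..1} K"
    unfolding K_def by (rule integral_continuous_on_param[OF contE])
  have dK: "(K has_vector_derivative momentum X \<psi> b (\<Gamma> b t) \<bullet> W b t - momentum X \<psi> a (\<Gamma> a t) \<bullet> W a t) (at t)"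
    if t: "t \<in> I" for t
  proof -
    obtain e where e: "e > 0" "cball t e \<subseteq> I" using I(1) t open_contains_cball by blast
    define N where "N = {t - e..t + e}"
    have N: "N \<subseteq> I" "t \<in> interior N" "t \<in> N" "convex N"
      using e by (auto simp: N_def cball_eq_atLeastAtMost)
    have "(K has_vector_derivative integral (cbox a b) (\<lambda>\<zeta>. dE \<zeta> t)) (at t within N)"
      unfolding K_def
    proof (rule leibniz_rule_vector_derivative[OF _ _ _ N(3,4)])
      show "((\<lambda>t. E (\<zeta>, \<Gamma> \<zeta> t)) has_vector_derivative dE \<zeta> s) (at s within N)" if "s \<in> N" "\<zeta> \<in> cbox a b" for s \<zeta>
        unfolding dE_def using that N(1) I(3)
        by (intro has_vector_derivative_at_within[OF dF[OF E']]) auto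
      show "(\<lambda>\<zeta>. E (\<zeta>, \<Gamma> \<zeta> s)) integrable_on cbox a b" if "s \<in> N" for s
        using that N(1) I(3)
        by (intro integrable_continuous continuous_on_compose2[OF contE, of "cbox a b" "\<lambda>\<zeta>. (s, \<zeta>)", unfolded prod.case])
          (auto intro!: continuous_intros)
      show "continuous_on (N \<times> cbox a b) (\<lambda>(s, \<zeta>). dE \<zeta> s)"
        using N(1) unfolding case_prod_unfold cbox_interval
        by (intro continuous_on_compose2[OF cont_dE, of _ "\<lambda>x. (snd x, fst x)", unfolded fst_conv snd_conv])
          (auto intro!: continuous_intros)
    qed
    then show ?thesis
      unfolding at_within_interior[OF N(2)] cbox_interval integral_unique[OF flow[OF t]] .
  qed
  have "((\<lambda>t. momentum X \<psi> b (\<Gamma> b t) \<bullet> vector_derivative (\<Gamma> b) (at t)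
         - momentum X \<psi> a (\<gamma> t) \<bullet> vector_derivative \<gamma> (at t)) has_integral K 1 - K 0) {0..1}"
  proof (rule fundamental_theorem_of_calculus_interior_strong[OF S(1) _ _ contK])
    fix t assume "t \<in> {0<..<1} - S"
    then have t: "t \<in> I" "t \<in> {0..1}" using I(3) by (auto simp: I_def)
    have "W a t = \<gamma>' t"
    proof (rule vector_derivative_unique_at[OF d\<Gamma>[OF aI t(1)]])
      show "(\<Gamma> a has_vector_derivative \<gamma>' t) (at t)"
        by (rule has_vector_derivative_transform_within_open[OF d\<gamma>[OF t(1)] I(1) t(1)]) (use \<Gamma>a I(3) in auto)
    qed
    then show "(K has_vector_derivative momentum X \<psi> b (\<Gamma> b t) \<bullet> vector_derivative (\<Gamma> b) (at t)
         - momentum X \<psi> a (\<gamma> t) \<bullet> vector_derivative \<gamma> (at t)) (at t)"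
      using dK[OF t(1)] vector_derivative_at[OF d\<Gamma>[OF bI t(1)]] \<Gamma>a[OF t(2)] by (simp add: \<gamma>'_def)
  qed simp
  moreover have "K 1 = K 0"
    using \<gamma>(2) by (simp add: K_def \<Gamma>_def transported_def pathfinish_def pathstart_def)
  ultimately show "((\<lambda>t. momentum X \<psi> b (transported \<gamma> b t) \<bullet> vector_derivative (transported \<gamma> b) (at t)
         - momentum X \<psi> a (\<gamma> t) \<bullet> vector_derivative \<gamma> (at t)) has_integral 0) {0..1}"
    by (simp add: \<Gamma>_def)
  have "continuous_on {0..1} (\<Gamma> b)"
    using bI
    by (intro continuous_on_compose2[OF continuous_on_snd[OF cont\<Gamma>], of _ "\<lambda>t. (b, t)", unfolded fst_conv snd_conv])
      (auto intro!: continuous_intros)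
  moreover have "\<Gamma> b C1_differentiable_on {0..1} - (S \<union> {0, 1})"
  proof -
    have "continuous_on I (W b)"
      using bI by (intro continuous_on_compose2[OF contW, of _ "\<lambda>t. (b, t)", unfolded fst_conv snd_conv]) (auto intro!: continuous_intros)
    moreover have "{0..1} - (S \<union> {0, 1}) = I" by (auto simp: I_def)
    ultimately show ?thesis
      unfolding C1_differentiable_on_def using d\<Gamma>[OF bI] by auto
  qed
  ultimately show "valid_path (transported \<gamma> b)"
    unfolding valid_path_def piecewise_C1_differentiable_on_def \<Gamma>_def
    using S(1) by (intro conjI exI[of _ "S \<union> {0, 1}"]) auto
qed

end

lemma spatial_path_restrict:
  assumes X: "smooth_on U X" and \<psi>: "smooth_on U (\<lambda>(s, w). \<psi> s w)"
  shows "spatial_path X \<psi> {x \<in> U. vol_dens X (fst x) (snd x) \<noteq> 0 \<and> rho_dens \<psi> (fst x) (snd x) \<noteq> 0}"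
    (is "spatial_path X \<psi> ?V")
proof -
  have "open U" using X by (simp add: smooth_on_def)
  moreover have "continuous_on U (\<lambda>x. vol_dens X (fst x) (snd x) * rho_dens \<psi> (fst x) (snd x))"
    by (intro continuous_intros C1_onD(3)[OF C1_on_vol_dens[OF X]] C1_onD(3)[OF C1_on_rho_dens[OF \<psi>]])
  ultimately have "open (U \<inter> (\<lambda>x. vol_dens X (fst x) (snd x) * rho_dens \<psi> (fst x) (snd x)) -` (-{0}))"
    by (intro continuous_open_preimage) auto
  also have "U \<inter> (\<lambda>x. vol_dens X (fst x) (snd x) * rho_dens \<psi> (fst x) (snd x)) -` (-{0}) = ?V"
    by auto
  finally have "open ?V" .
  then have "smooth_on ?V X" "smooth_on ?V (\<lambda>(s, w). \<psi> s w)"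
    using smooth_on_subset[OF X] smooth_on_subset[OF \<psi>] by auto
  then show ?thesis by unfold_locales auto
qed

theorem theorem3:
  fixes \<Gamma>0 P0 \<zeta>1 \<zeta>2 :: real
    and ph :: "complex \<Rightarrow> real"
    and Q :: "(real^3) set"
    and X :: "real \<times> complex \<Rightarrow> real^3"
    and J :: "real set"
    and \<psi> :: "real \<Rightarrow> complex \<Rightarrow> complex"
    and \<gamma>1 \<gamma>2 :: "real \<Rightarrow> complex"
  assumes "\<Gamma>0 > 0"
    and "nondegenerate_pressure \<Gamma>0 ph"
    and "regular_value \<Gamma>0 ph P0"
    and "toroidal_domain Q X"
    and "is_interval J"
    and "diffeo_path \<Gamma>0 J \<psi>"
    and "\<forall>\<zeta>\<in>J. \<forall>z\<in>unit_disc. EL_eq X ph \<psi> \<zeta> z"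
    and "\<zeta>1 \<in> J" and "\<zeta>2 \<in> J" and "\<zeta>1 \<le> \<zeta>2"
    and "pos_oriented_param (isobar ph \<psi> \<zeta>1 P0) \<gamma>1"
    and "pos_oriented_param (isobar ph \<psi> \<zeta>2 P0) \<gamma>2"
  shows "line_int (momentum X \<psi> \<zeta>1) \<gamma>1 = line_int (momentum X \<psi> \<zeta>2) \<gamma>2"
proof -
  have J: "{\<zeta>1..\<zeta>2} \<subseteq> J"
    using mem_is_interval_1_I[OF assms(5,8,9)] by auto
  obtain UX where UX: "UNIV \<times> unit_disc \<subseteq> UX" "smooth_on UX X"
    and vol: "\<And>\<zeta> z. z \<in> unit_disc \<Longrightarrow> vol_dens X \<zeta> z > 0"
    using assms(4) unfolding toroidal_domain_def toroidal_param_def smooth_near_def vol_dens_def Xd_def by metis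
  obtain U\<psi> where U\<psi>: "J \<times> unit_disc \<subseteq> U\<psi>" "smooth_on U\<psi> (\<lambda>(s, w). \<psi> s w)"
    using assms(6) unfolding diffeo_path_def smooth_near_def by blast
  have bijJ: "bij_betw (\<psi> \<zeta>) unit_disc (disc_area \<Gamma>0)" and rho: "\<And>z. z \<in> unit_disc \<Longrightarrow> rho_dens \<psi> \<zeta> z \<noteq> 0" if "\<zeta> \<in> J" for \<zeta>
    using assms(6) that unfolding diffeo_path_def by auto
  obtain V where V: "disc_area \<Gamma>0 \<subseteq> V" "smooth_on V ph"
    using assms(2) unfolding nondegenerate_pressure_def smooth_near_def by blast
  define U where "U = {x \<in> UX \<inter> U\<psi>. vol_dens X (fst x) (snd x) \<noteq> 0 \<and> rho_dens \<psi> (fst x) (snd x) \<noteq> 0}"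
  have "open (UX \<inter> U\<psi>)" using UX(2) U\<psi>(2) by (auto simp: smooth_on_def)
  then interpret spatial_path X \<psi> U
    unfolding U_def by (intro spatial_path_restrict smooth_on_subset[OF UX(2)] smooth_on_subset[OF U\<psi>(2)]) auto
  have JU: "J \<times> unit_disc \<subseteq> U"
  proof
    fix x assume x: "x \<in> J \<times> unit_disc"
    then have "vol_dens X (fst x) (snd x) \<noteq> 0" "rho_dens \<psi> (fst x) (snd x) \<noteq> 0"
      using vol[of "snd x" "fst x"] rho[of "fst x" "snd x"] by (auto simp del: mem_cball mem_cball_0)
    moreover have "x \<in> UX \<inter> U\<psi>" using x UX(1) U\<psi>(1) by (auto simp del: mem_cball mem_cball_0)
    ultimately show "x \<in> U" by (simp add: U_def)
  qed
  interpret transport X \<psi> U \<zeta>1 \<zeta>2 "disc_area \<Gamma>0"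
    using assms(10) JU J bijJ by unfold_locales auto
  have img: "\<psi> \<zeta> ` unit_disc \<subseteq> V" if "\<zeta> \<in> J" for \<zeta>
    using bijJ[OF that] V(1) by (auto simp: bij_betw_def)
  have regular: "frechet_derivative ph (at (\<psi> \<zeta> z)) \<noteq> (\<lambda>_. 0)" if "\<zeta> \<in> J" "z \<in> isobar ph \<psi> \<zeta> P0" for \<zeta> z
  proof -
    have "\<psi> \<zeta> z \<in> disc_area \<Gamma>0" "ph (\<psi> \<zeta> z) = P0"
      using bijJ[OF that(1)] that(2) by (auto simp: isobar_def pres_def bij_betw_def)
    then show ?thesis using assms(3) by (simp add: regular_value_def)
  qed
  have slice: "{\<zeta>} \<times> unit_disc \<subseteq> U" if "\<zeta> \<in> J" for \<zeta> using JU that by blast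
  note unique = isobar_circulation_unique[OF V(2) slice img regular]
  define \<beta> where "\<beta> = transported \<gamma>1 \<zeta>2"
  obtain w where w: "w \<notin> path_image \<gamma>1" "winding_number \<gamma>1 w = 1"
    using assms(11) unfolding pos_oriented_param_def by metis
  have ph_diff: "ph differentiable (at q)" if "q \<in> disc_area \<Gamma>0" for q
    using C1_onD(1)[OF smooth_on_imp_C1_on(1)[OF V(2)]] V(1) that by (auto simp: differentiable_def)
  have level: "ph (\<psi> \<zeta>1 (\<gamma>1 t)) = P0" if "t \<in> {0..1}" for t
  proof -
    have "\<gamma>1 t \<in> isobar ph \<psi> \<zeta>1 P0" using assms(11) that unfolding pos_oriented_param_def path_image_def by blast
    then show ?thesis by (simp add: isobar_def pres_def)
  qed
  have EL: "EL_eq X ph \<psi> \<zeta> z" if "\<zeta> \<in> {\<zeta>1..\<zeta>2}" "z \<in> unit_disc" for \<zeta> z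
    using assms(7) J that by blast
  have \<gamma>1': "valid_path \<gamma>1" "simple_path \<gamma>1" "pathfinish \<gamma>1 = pathstart \<gamma>1" "path_image \<gamma>1 = isobar ph \<psi> \<zeta>1 P0"
    using assms(11) by (simp_all add: pos_oriented_param_def)
  have \<gamma>1_disc: "path_image \<gamma>1 \<subseteq> unit_disc" unfolding \<gamma>1'(4) isobar_def by blast
  note circ = transported_circulation[OF \<gamma>1'(1,3) \<gamma>1_disc ph_diff level EL]
  note loop = transported_simple_loop[OF \<gamma>1'(2,3) \<gamma>1_disc w]
  have "pos_oriented_param (isobar ph \<psi> \<zeta>2 P0) \<beta>"
    using circ(1) loop path_image_transported_isobar[OF \<gamma>1'(4)] unfolding pos_oriented_param_def \<beta>_def by auto
  from unique[OF assms(9) assms(9) assms(9) _ this assms(12)] obtain I2 where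
    I2: "((\<lambda>t. momentum X \<psi> \<zeta>2 (\<beta> t) \<bullet> vector_derivative \<beta> (at t)) has_integral I2) {0..1}"
    "((\<lambda>t. momentum X \<psi> \<zeta>2 (\<gamma>2 t) \<bullet> vector_derivative \<gamma>2 (at t)) has_integral I2) {0..1}"
    by blast
  from has_integral_diff[OF I2(1) circ(2)[folded \<beta>_def]]
  have "((\<lambda>t. momentum X \<psi> \<zeta>1 (\<gamma>1 t) \<bullet> vector_derivative \<gamma>1 (at t)) has_integral I2) {0..1}"
    by simp
  with I2(2) show ?thesis
    unfolding line_int_def by (simp add: integral_unique)
qed

end
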